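(* Let $A=(a(1),\dots,a(n))$ be a $d\times n$ matrix with rational entries such that $(a(1),\dots,a(d))$ is the identity matrix and: (1) for $j=d+1,\dots,n-1$, $a(j)$ has all coordinates positive and $|a(j)|<1$; (2) $a(n)$ has all coordinates positive and $|a(n)|>1$. Let $p\in\mathbb{Z}^d$, $\delta\in\mathbb{R}^d$ with $|\delta_k|<1/2$ for all $k$, and $y\in\mathbb{C}^{n-d-1}\times S_{p,\delta}$. Then the function $F(\beta;y)=F_{p,\delta}(\beta;y)$ (defined by a convergent integral for $\Re\beta_k<0$, $k=1,\dots,d$) admits a meromorphic continuation with respect to $\beta\in\mathbb{C}^d$, denoted $\widetilde F(\beta;y)$, with poles at most along the countable locally finite union of hyperplanes $$\mathcal P=\bigcup_{k=1}^d\{\beta\in\mathbb{C}^d\mid\beta_k\in\pi_k(\mathbb{N}A)\},$$ where $\pi_k:\mathbb{Q}^d\to\mathbb{Q}$ denotes the projection to the $k$-th coordinate.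
   Context: Notation: $\mathbb{N}$ contains $0$; $\mathbb{N}A=\sum_{\ell=1}^n\mathbb{N}a(\ell)$; $\mathbf 1=(1,\dots,1)\in\mathbb{N}^d$; $|a|=a_1+\cdots+a_d$ for $a\in\mathbb{Q}^d$; $\langle u,v\rangle=\sum_k u_kv_k$. The universal covering of $(\mathbb{C}^* )^d$ has coordinates $(r,\theta)$, $r_k=|t_k|>0$, $\theta_k=\arg t_k\in\mathbb{R}$, and $t^v=\exp\big(\sum_kv_k(\log r_k+\sqrt{-1}\,\theta_k)\big)$ for $v\in\mathbb{C}^d$. $D_{p,\delta}$ is the set of points of this covering with $\arg t_k=(1+\delta_k+2p_k)\pi$ for $k=1,\dots,d$, parametrized (and oriented) by $(r_1,\dots,r_d)\in\mathbb{R}_{>0}^d$, and for $y=(y_{d+1},\dots,y_n)$, $$F_{p,\delta}(\beta;y)=\int_{D_{p,\delta}}t^{-\beta-\mathbf 1}\exp\Big(t_1+\cdots+t_d+\sum_{j=d+1}^ny_jt^{a(j)}\Big)dt .$$ $S_{p,\delta}\subset\mathbb{C}^*$ is the open sector of those $y_n$ with $\arg y_n+\langle\mathbf 1+\delta+2p,a(n)\rangle\pi\in\,]\pi/2,3\pi/2[\,+2\pi\mathbb{Z}$. *)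

theory Defs
  imports "HOL-Analysis.Analysis"
begin

(* Functions on C^d. The domain is complex ^ 'd, where d = CARD('d); only real Frechet derivatives
   are available there, so complex linearity of the derivative is required explicitly. *)

definition holomorphic_on_vec :: "(complex ^ 'd \<Rightarrow> complex) \<Rightarrow> (complex ^ 'd) set \<Rightarrow> bool"
  (infixl \<open>holomorphic'_on'_vec\<close> 50) where
  "f holomorphic_on_vec U \<longleftrightarrow>
     (\<forall>z\<in>U. \<exists>D. (f has_derivative D) (at z) \<and> (\<forall>c v. D (c *s v) = c * D v))"

(* Locally a quotient g / h with h not identically zero on a connected neighbourhood. The value of f
   where a denominator vanishes is not prescribed here; the polar locus is bounded separately, by
   requiring f to be holomorphic outside a given set. *)

definition meromorphic_on_vec :: "(complex ^ 'd \<Rightarrow> complex) \<Rightarrow> (complex ^ 'd) set \<Rightarrow> bool"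
  (infixl \<open>meromorphic'_on'_vec\<close> 50) where
  "f meromorphic_on_vec U \<longleftrightarrow>
     (\<forall>z\<in>U. \<exists>V g h. open V \<and> connected V \<and> z \<in> V \<and> V \<subseteq> U \<and>
        g holomorphic_on_vec V \<and> h holomorphic_on_vec V \<and> (\<exists>w\<in>V. h w \<noteq> 0) \<and>
        (\<forall>w\<in>V. h w \<noteq> 0 \<longrightarrow> f w = g w / h w))"

(* The power t^v at the point (r, \<theta>) of the universal covering of (C^* )^d. *)

definition cover_powr :: "real ^ 'd \<Rightarrow> real ^ 'd \<Rightarrow> complex ^ 'd \<Rightarrow> complex" where
  "cover_powr r \<theta> v =
     exp (\<Sum>k\<in>UNIV. v $ k * (complex_of_real (ln (r $ k)) + \<i> * complex_of_real (\<theta> $ k)))"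

definition rat_vec :: "rat ^ 'd \<Rightarrow> 'a::field_char_0 ^ 'd" where
  "rat_vec v = (\<chi> k. of_rat (v $ k))"

definition cycle_arg :: "int ^ 'd \<Rightarrow> real ^ 'd \<Rightarrow> real ^ 'd" where
  "cycle_arg p \<delta> = (\<chi> k. (1 + \<delta> $ k + 2 * of_int (p $ k)) * pi)"

(* Throughout, a l is the l-th column (l = 1..n) of the d x n matrix A. Only the values y j with
   CARD('d) < j \<le> n of y are used. On the cycle t_k = r_k exp(i \<theta>_k) with \<theta> constant, so that
   dt = (\<Prod>k. exp(i \<theta>_k)) dr, which is the last factor below. *)

definition F_integrand ::
  "nat \<Rightarrow> (nat \<Rightarrow> rat ^ 'd) \<Rightarrow> int ^ 'd \<Rightarrow> real ^ 'd \<Rightarrow> complex ^ 'd \<Rightarrow> (nat \<Rightarrow> complex)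
    \<Rightarrow> real ^ 'd \<Rightarrow> complex" where
  "F_integrand n a p \<delta> \<beta> y r =
     (let \<theta> = cycle_arg p \<delta> in
      cover_powr r \<theta> (- \<beta> - 1) *
      exp ((\<Sum>k\<in>UNIV. rcis (r $ k) (\<theta> $ k)) +
           (\<Sum>j = CARD('d) + 1..n. y j * cover_powr r \<theta> (rat_vec (a j)))) *
      (\<Prod>k\<in>UNIV. cis (\<theta> $ k)))"

definition pos_orthant :: "(real ^ 'd) set" where
  "pos_orthant = {r. \<forall>k. 0 < r $ k}"

definition F_integral ::
  "nat \<Rightarrow> (nat \<Rightarrow> rat ^ 'd) \<Rightarrow> int ^ 'd \<Rightarrow> real ^ 'd \<Rightarrow> complex ^ 'd \<Rightarrow> (nat \<Rightarrow> complex)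
    \<Rightarrow> complex" where
  "F_integral n a p \<delta> \<beta> y = (LINT r:pos_orthant|lborel. F_integrand n a p \<delta> \<beta> y r)"

definition sector :: "nat \<Rightarrow> (nat \<Rightarrow> rat ^ 'd) \<Rightarrow> int ^ 'd \<Rightarrow> real ^ 'd \<Rightarrow> complex set" where
  "sector n a p \<delta> =
     {z. z \<noteq> 0 \<and>
         (\<exists>m::int. Arg z + (\<Sum>k\<in>UNIV. (1 + \<delta> $ k + 2 * of_int (p $ k)) * of_rat (a n $ k)) * pi
            \<in> {pi / 2 + 2 * pi * of_int m <..< 3 * pi / 2 + 2 * pi * of_int m})}"

definition column_monoid :: "nat \<Rightarrow> (nat \<Rightarrow> rat ^ 'd) \<Rightarrow> (rat ^ 'd) set" where
  "column_monoid n a = {\<Sum>l = 1..n. of_nat (c l) *s a l | c :: nat \<Rightarrow> nat. True}"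

definition polar_hyperplanes :: "nat \<Rightarrow> (nat \<Rightarrow> rat ^ 'd) \<Rightarrow> (complex ^ 'd) set set" where
  "polar_hyperplanes n a =
     {{\<beta>. \<beta> $ k = of_rat q} | k q. q \<in> (\<lambda>v. v $ k) ` column_monoid n a}"

definition polar_set :: "nat \<Rightarrow> (nat \<Rightarrow> rat ^ 'd) \<Rightarrow> (complex ^ 'd) set" where
  "polar_set n a = (\<Union>k. {\<beta>. \<beta> $ k \<in> of_rat ` (\<lambda>v. v $ k) ` column_monoid n a})"

end

(* Scaling the k-th variable shows that I(beta) = F(beta; y) satisfies, for Re beta < 0,
     beta_k I(beta) = sum_l a(l)_k y_l I(beta - a(l)),   where y_1 = ... = y_d = 1.
   Only columns with a(l)_k > 0 contribute, so the right-hand side makes sense on a half-space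
   strictly larger in the k-th direction, and dividing by beta_k continues I there. Iterating over
   all directions exhausts C^d, and the poles created along beta_k = 0 are translated by columns
   of A only. *)
theory Submission
  imports Defs
begin

section \<open>Holomorphic functions of several variables\<close>

text \<open>The scaling identity comes from scaling t_k by exp x inside the exponential factor only
  and differentiating the integral at x = 0. A change of variables evaluates that integral exactly,
  so no integration by parts and no boundary terms occur. The analytic input is one estimate: on the
  cycle the real part of the exponent is at most B - \<epsilon> (r_1 + ... + r_d). The linear terms
  give the decay, since |\<delta>_k| < 1/2 puts every t_k in the left half-plane. The middle columns
  have degree below 1 and are absorbed. The last column has degree above 1 and would win against the
  linear terms, so it is controlled by sign: the sector makes its real part nonpositive. Finitely
  many columns have a least nonzero entry, so each step gains at least a fixed amount and every
  point is reached after finitely many steps. The polar set enters through two properties: it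
  contains the hyperplanes \<beta>_k = 0 and is stable under adding columns. Meromorphy says more
  than holomorphy off the polar set, so a quotient with entire denominator is carried through the
  induction as well.\<close>

definition complex_vec :: "real ^ 'd \<Rightarrow> complex ^ 'd" where
  "complex_vec v = (\<chi> i. complex_of_real (v $ i))"

lemma complex_vec_nth [simp]: "complex_vec v $ i = of_real (v $ i)"
  by (simp add: complex_vec_def)

lemma holomorphic_on_vecI:
  assumes "\<And>z. z \<in> U \<Longrightarrow> \<exists>D. (f has_derivative D) (at z) \<and> (\<forall>c v. D (c *s v) = c * D v)"
  shows "f holomorphic_on_vec U"
  using assms unfolding holomorphic_on_vec_def by blast

lemma holomorphic_on_vec_subset:
  "f holomorphic_on_vec U \<Longrightarrow> V \<subseteq> U \<Longrightarrow> f holomorphic_on_vec V"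
  unfolding holomorphic_on_vec_def by blast

lemma holomorphic_on_vec_const: "(\<lambda>_. c) holomorphic_on_vec U"
  by (rule holomorphic_on_vecI, rule exI[of _ "\<lambda>_. 0"]) auto

lemma holomorphic_on_vec_nth: "(\<lambda>z. z $ k) holomorphic_on_vec U"
  by (rule holomorphic_on_vecI, rule exI[of _ "\<lambda>z. z $ k"])
     (auto intro!: bounded_linear_imp_has_derivative bounded_linear_vec_nth)

lemma holomorphic_on_vec_add:
  assumes "f holomorphic_on_vec U" "g holomorphic_on_vec U"
  shows "(\<lambda>z. f z + g z) holomorphic_on_vec U"
proof (rule holomorphic_on_vecI)
  fix z assume "z \<in> U"
  then obtain D E where D: "(f has_derivative D) (at z)" "\<forall>c v. D (c *s v) = c * D v"
    and E: "(g has_derivative E) (at z)" "\<forall>c v. E (c *s v) = c * E v"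
    using assms unfolding holomorphic_on_vec_def by blast
  show "\<exists>D. ((\<lambda>z. f z + g z) has_derivative D) (at z) \<and> (\<forall>c v. D (c *s v) = c * D v)"
    by (rule exI[of _ "\<lambda>v. D v + E v"])
       (use D E in \<open>auto intro!: has_derivative_add simp: algebra_simps\<close>)
qed

lemma holomorphic_on_vec_mult:
  assumes "f holomorphic_on_vec U" "g holomorphic_on_vec U"
  shows "(\<lambda>z. f z * g z) holomorphic_on_vec U"
proof (rule holomorphic_on_vecI)
  fix z assume "z \<in> U"
  then obtain D E where D: "(f has_derivative D) (at z)" "\<forall>c v. D (c *s v) = c * D v"
    and E: "(g has_derivative E) (at z)" "\<forall>c v. E (c *s v) = c * E v"
    using assms unfolding holomorphic_on_vec_def by blast
  show "\<exists>D. ((\<lambda>z. f z * g z) has_derivative D) (at z) \<and> (\<forall>c v. D (c *s v) = c * D v)"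
    by (rule exI[of _ "\<lambda>v. f z * E v + D v * g z"])
       (use has_derivative_mult[OF D(1) E(1)] D(2) E(2) in \<open>auto simp: algebra_simps\<close>)
qed

lemma holomorphic_on_vec_inverse:
  assumes "f holomorphic_on_vec U" "\<And>z. z \<in> U \<Longrightarrow> f z \<noteq> 0"
  shows "(\<lambda>z. inverse (f z)) holomorphic_on_vec U"
proof (rule holomorphic_on_vecI)
  fix z assume z: "z \<in> U"
  then obtain D where D: "(f has_derivative D) (at z)" "\<forall>c v. D (c *s v) = c * D v"
    using assms unfolding holomorphic_on_vec_def by blast
  show "\<exists>D. ((\<lambda>z. inverse (f z)) has_derivative D) (at z) \<and> (\<forall>c v. D (c *s v) = c * D v)"
    by (rule exI[of _ "\<lambda>v. - (inverse (f z) * D v * inverse (f z))"])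
       (use Deriv.has_derivative_inverse[OF assms(2)[OF z] D(1)] D(2) in \<open>auto simp: algebra_simps\<close>)
qed

lemma holomorphic_on_vec_sum:
  assumes "\<And>i. i \<in> I \<Longrightarrow> f i holomorphic_on_vec U"
  shows "(\<lambda>z. \<Sum>i\<in>I. f i z) holomorphic_on_vec U"
  using assms
  by (induction I rule: infinite_finite_induct)
     (auto intro: holomorphic_on_vec_const holomorphic_on_vec_add)

lemma holomorphic_on_vec_prod:
  assumes "\<And>i. i \<in> I \<Longrightarrow> f i holomorphic_on_vec U"
  shows "(\<lambda>z. \<Prod>i\<in>I. f i z) holomorphic_on_vec U"
  using assms
  by (induction I rule: infinite_finite_induct)
     (auto intro: holomorphic_on_vec_const holomorphic_on_vec_mult)

lemma holomorphic_on_vec_shift: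
  assumes "f holomorphic_on_vec V" "\<And>z. z \<in> U \<Longrightarrow> z - w \<in> V"
  shows "(\<lambda>z. f (z - w)) holomorphic_on_vec U"
proof (rule holomorphic_on_vecI)
  fix z assume z: "z \<in> U"
  then obtain D where D: "(f has_derivative D) (at (z - w))" "\<forall>c v. D (c *s v) = c * D v"
    using assms unfolding holomorphic_on_vec_def by blast
  have "((\<lambda>z. f (z - w)) has_derivative (\<lambda>v. D v)) (at z)"
    by (rule has_derivative_compose[of "\<lambda>z. z - w" "\<lambda>v. v", OF _ D(1)])
       (auto intro!: derivative_eq_intros)
  thus "\<exists>D. ((\<lambda>z. f (z - w)) has_derivative D) (at z) \<and> (\<forall>c v. D (c *s v) = c * D v)"
    using D(2) by blast
qed

text \<open>Two sets are needed because \<open>U\<close> will be \<open>region ks - P\<close> with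
  an arbitrary \<open>P\<close>, which need not be open. The derivative is taken on a full
  neighbourhood, so the functions must agree on an open superset.\<close>

lemma holomorphic_on_vec_transform:
  assumes "f holomorphic_on_vec U" "open V" "U \<subseteq> V" "\<And>z. z \<in> V \<Longrightarrow> f z = g z"
  shows "g holomorphic_on_vec U"
  using assms has_derivative_transform_within_open[of f _ _ UNIV V g]
  unfolding holomorphic_on_vec_def by (metis subsetD)


section \<open>Continuation by a functional equation\<close>

text \<open>Every continuation step is an explicit formula, so different numbers of steps agree where they
  overlap by induction alone, without an identity theorem in several variables.\<close>

locale shift_equation =
  fixes L :: "'l set" and A :: "'l \<Rightarrow> real ^ 'd::finite" and c :: "'l \<Rightarrow> 'd \<Rightarrow> complex"
    and G :: "complex ^ 'd \<Rightarrow> complex" and P :: "(complex ^ 'd) set"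
  assumes fin: "finite L"
    and nonneg: "l \<in> L \<Longrightarrow> 0 \<le> A l $ k"
    and coeff0: "l \<in> L \<Longrightarrow> A l $ k = 0 \<Longrightarrow> c l k = 0"
    and hol: "G holomorphic_on_vec {\<beta>. \<forall>k. Re (\<beta> $ k) < 0}"
    and eq: "(\<And>j. Re (\<beta> $ j) < 0) \<Longrightarrow>
      \<beta> $ k * G \<beta> = (\<Sum>l\<in>L. c l k * G (\<beta> - complex_vec (A l)))"
    and polar0: "\<beta> $ k = 0 \<Longrightarrow> \<beta> \<in> P"
    and polar_shift: "l \<in> L \<Longrightarrow> \<beta> - complex_vec (A l) \<in> P \<Longrightarrow> \<beta> \<in> P"
begin

text \<open>The functional equation solved for its left-hand side. At \<open>\<beta> $ k = 0\<close>
  the convention \<open>inverse 0 = 0\<close> gives the value 0; such points lie in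
  \<open>P\<close>.\<close>

definition step :: "'d \<Rightarrow> (complex ^ 'd \<Rightarrow> complex) \<Rightarrow> complex ^ 'd \<Rightarrow> complex" where
  "step k f \<beta> = inverse (\<beta> $ k) * (\<Sum>l\<in>L. c l k * f (\<beta> - complex_vec (A l)))"

text \<open>The guaranteed gain of one step in its direction. Inserting 1 keeps the set nonempty
  when there is no nonzero entry.\<close>

definition mesh :: real where
  "mesh = Min (insert 1 {A l $ k | l k. l \<in> L \<and> A l $ k \<noteq> 0})"

lemma finite_entries: "finite {A l $ k | l k. l \<in> L \<and> A l $ k \<noteq> 0}"
  by (rule finite_subset[of _ "(\<lambda>(l, k). A l $ k) ` (L \<times> UNIV)"]) (use fin in auto)

lemma mesh_pos: "mesh > 0"
proof -
  have "\<forall>x\<in>insert 1 {A l $ k | l k. l \<in> L \<and> A l $ k \<noteq> 0}. 0 < x"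
    using nonneg by (force simp: less_le)
  thus ?thesis unfolding mesh_def using finite_entries by (subst Min_gr_iff) auto
qed

lemma mesh_le: "l \<in> L \<Longrightarrow> A l $ k \<noteq> 0 \<Longrightarrow> mesh \<le> A l $ k"
  unfolding mesh_def using finite_entries by (intro Min_le) auto

text \<open>The domain reached by the steps listed in \<open>ks\<close>: each occurrence of a
  direction moves its bound by \<open>mesh\<close>. The empty list gives the domain on which
  \<open>G\<close> is known.\<close>

definition region :: "'d list \<Rightarrow> (complex ^ 'd) set" where
  "region ks = {\<beta>. \<forall>k. Re (\<beta> $ k) < mesh * real (count_list ks k)}"

text \<open>A nonzero coefficient forces a nonzero entry, which pays for the extra
  \<open>mesh\<close> in direction \<open>k\<close>; nonnegativity keeps the other coordinates
  within their bounds.\<close>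

lemma region_Cons_shift:
  assumes "\<beta> \<in> region (k # ks)" "l \<in> L" "c l k \<noteq> 0"
  shows "\<beta> - complex_vec (A l) \<in> region ks"
proof -
  have *: "mesh \<le> A l $ k" using assms mesh_le coeff0 by blast
  show ?thesis unfolding region_def
  proof (intro CollectI allI)
    fix j
    have "Re (\<beta> $ j) < mesh * real (count_list (k # ks) j)"
      using assms(1) unfolding region_def by blast
    thus "Re ((\<beta> - complex_vec (A l)) $ j) < mesh * real (count_list ks j)"
      using * nonneg[OF assms(2), of j] by (cases "j = k") (auto simp: algebra_simps)
  qed
qed

lemma region_Nil_shift: "\<beta> \<in> region [] \<Longrightarrow> l \<in> L \<Longrightarrow> \<beta> - complex_vec (A l) \<in> region []"
  using nonneg unfolding region_def by (fastforce intro: order.strict_trans2)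

lemma region_Nil_subset: "region [] \<subseteq> region ks"
  unfolding region_def using mesh_pos by (auto intro: less_le_trans)

lemma open_region: "open (region ks)"
proof -
  have "region ks = (\<Inter>k. {\<beta>. Re (\<beta> $ k) < mesh * real (count_list ks k)})"
    by (auto simp: region_def)
  thus ?thesis by (simp only:) (intro open_INT ballI open_Collect_less continuous_intros; simp)
qed

lemma connected_region: "connected (region ks)"
proof -
  have "region ks = (\<Inter>k. (\<lambda>\<beta>. Re (\<beta> $ k)) -` {..<mesh * real (count_list ks k)})"
    by (auto simp: region_def)
  moreover have "linear (\<lambda>\<beta>::complex ^ 'd. Re (\<beta> $ k))" for k
    by (auto intro!: linearI)
  ultimately have "convex (region ks)"
    by (simp only:) (intro convex_INT convex_linear_vimage; simp)
  thus ?thesis by (rule convex_connected)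
qed

lemma step_cong:
  assumes "\<And>\<beta>. \<beta> \<in> region ks \<Longrightarrow> f \<beta> = g \<beta>" "\<beta> \<in> region (k # ks)"
  shows "step k f \<beta> = step k g \<beta>"
proof -
  \<comment> \<open>A column with coefficient 0 may send the argument outside
    \<open>region ks\<close>, but its term vanishes on both sides.\<close>
  have "c l k * f (\<beta> - complex_vec (A l)) = c l k * g (\<beta> - complex_vec (A l))" if "l \<in> L" for l
    using assms(1)[OF region_Cons_shift[OF assms(2) that]] by (cases "c l k = 0") auto
  hence "(\<Sum>l\<in>L. c l k * f (\<beta> - complex_vec (A l))) = (\<Sum>l\<in>L. c l k * g (\<beta> - complex_vec (A l)))"
    by (intro sum.cong refl)
  thus ?thesis by (simp only: step_def)
qed

lemma step_G: "\<beta> \<in> region [] \<Longrightarrow> step k G \<beta> = G \<beta>"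
proof -
  assume "\<beta> \<in> region []"
  hence neg: "\<And>j. Re (\<beta> $ j) < 0" by (auto simp: region_def)
  hence "\<beta> $ k \<noteq> 0" by (metis less_irrefl zero_complex.simps(1))
  thus ?thesis using eq[OF neg, of k] by (simp add: step_def field_simps)
qed

definition cont :: "'d list \<Rightarrow> complex ^ 'd \<Rightarrow> complex" where
  "cont ks = foldr step ks G"

lemma cont_simps: "cont [] = G" "cont (k # ks) = step k (cont ks)"
  by (auto simp: cont_def)

text \<open>Shifts never leave the original domain, so there every step only restates the functional
  equation of \<open>G\<close>.\<close>

lemma cont_Nil: "\<beta> \<in> region [] \<Longrightarrow> cont ks \<beta> = G \<beta>"
proof (induction ks arbitrary: \<beta>)
  case (Cons k ks)
  have "step k (cont ks) \<beta> = step k G \<beta>"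
    unfolding step_def using Cons region_Nil_shift by (intro arg_cong2[of _ _ _ _ "(*)"] sum.cong) auto
  thus ?case using Cons by (simp add: cont_simps step_G)
qed (simp add: cont_simps)

text \<open>The appended steps are applied innermost, directly to \<open>G\<close>, and do not
  change it on \<open>region []\<close>. The outer steps, each evaluated on its own region,
  therefore see the same values. This is what makes the continuations compatible.\<close>

lemma cont_append: "\<beta> \<in> region ks \<Longrightarrow> cont (ks @ ks') \<beta> = cont ks \<beta>"
proof (induction ks arbitrary: \<beta>)
  case Nil thus ?case by (simp add: cont_Nil cont_simps)
next
  case (Cons k ks) thus ?case by (auto simp: cont_simps intro!: step_cong)
qed

text \<open>Read contrapositively, \<open>polar_shift\<close> keeps the shifted arguments outside
  \<open>P\<close>, and \<open>polar0\<close> keeps the new factor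
  \<open>inverse (\<beta> $ k)\<close> regular there.\<close>

lemma cont_holomorphic: "cont ks holomorphic_on_vec (region ks - P)"
proof (induction ks)
  case Nil
  show ?case using hol by (auto simp: cont_simps region_def intro: holomorphic_on_vec_subset)
next
  case (Cons k ks)
  have "(\<lambda>\<beta>. c l k * cont ks (\<beta> - complex_vec (A l))) holomorphic_on_vec (region (k # ks) - P)" if "l \<in> L" for l
  proof (cases "c l k = 0")
    case True thus ?thesis by (simp add: holomorphic_on_vec_const)
  next
    case False
    show ?thesis
    proof (intro holomorphic_on_vec_mult holomorphic_on_vec_const holomorphic_on_vec_shift[OF Cons])
      fix z assume "z \<in> region (k # ks) - P"
      thus "z - complex_vec (A l) \<in> region ks - P"
        using region_Cons_shift[OF _ that False] polar_shift[OF that] by auto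
    qed
  qed
  hence "(\<lambda>\<beta>. \<Sum>l\<in>L. c l k * cont ks (\<beta> - complex_vec (A l))) holomorphic_on_vec (region (k # ks) - P)"
    by (rule holomorphic_on_vec_sum)
  moreover have "(\<lambda>\<beta>. inverse (\<beta> $ k)) holomorphic_on_vec (region (k # ks) - P)"
    using polar0 by (intro holomorphic_on_vec_inverse holomorphic_on_vec_nth) auto
  ultimately show ?case unfolding cont_simps step_def by (intro holomorphic_on_vec_mult)
qed

text \<open>The denominator is kept entire so that all its translates may be multiplied, including
  those by columns of coefficient 0 that leave the region. Its nonvanishing on
  \<open>region []\<close> later shows that it is not identically zero.\<close>

lemma cont_quotient:
  "\<exists>g h. g holomorphic_on_vec (region ks) \<and> h holomorphic_on_vec UNIV \<and>
     (\<forall>\<beta>\<in>region []. h \<beta> \<noteq> 0) \<and> (\<forall>\<beta>\<in>region ks. h \<beta> \<noteq> 0 \<longrightarrow> cont ks \<beta> = g \<beta> / h \<beta>)"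
proof (induction ks)
  case Nil
  show ?case using hol
    by (intro exI[of _ G] exI[of _ "\<lambda>_. 1"]) (auto simp: cont_simps region_def holomorphic_on_vec_const)
next
  case (Cons k ks)
  then obtain g h where g: "g holomorphic_on_vec (region ks)" and h: "h holomorphic_on_vec UNIV"
    and h0: "\<And>\<beta>. \<beta> \<in> region [] \<Longrightarrow> h \<beta> \<noteq> 0"
    and gh: "\<And>\<beta>. \<beta> \<in> region ks \<Longrightarrow> h \<beta> \<noteq> 0 \<Longrightarrow> cont ks \<beta> = g \<beta> / h \<beta>" by blast
  \<comment> \<open>Common denominator: the new factor times all translates of the old one. Each
    numerator in \<open>g'\<close> is multiplied by the translates of the other columns.\<close>
  define h' where "h' \<beta> = \<beta> $ k * (\<Prod>l\<in>L. h (\<beta> - complex_vec (A l)))" for \<beta>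
  define g' where
    "g' \<beta> = (\<Sum>l\<in>L. c l k * g (\<beta> - complex_vec (A l)) * (\<Prod>m\<in>L - {l}. h (\<beta> - complex_vec (A m))))" for \<beta>
  have hsh: "(\<lambda>\<beta>. h (\<beta> - complex_vec (A l))) holomorphic_on_vec W" for l W
    by (rule holomorphic_on_vec_shift[OF h]) auto
  have "(\<lambda>\<beta>. c l k * g (\<beta> - complex_vec (A l))) holomorphic_on_vec region (k # ks)" if "l \<in> L" for l
  proof (cases "c l k = 0")
    case True thus ?thesis by (simp add: holomorphic_on_vec_const)
  next
    case False
    show ?thesis using region_Cons_shift[OF _ that False]
      by (intro holomorphic_on_vec_mult holomorphic_on_vec_const holomorphic_on_vec_shift[OF g])
  qed
  hence "g' holomorphic_on_vec region (k # ks)"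
    unfolding g'_def
    by (intro holomorphic_on_vec_sum holomorphic_on_vec_mult[where g = "\<lambda>z. prod (_ z) _"]
        holomorphic_on_vec_prod hsh)
  moreover have "h' holomorphic_on_vec UNIV"
    unfolding h'_def by (intro holomorphic_on_vec_mult holomorphic_on_vec_nth holomorphic_on_vec_prod hsh)
  moreover have "h' \<beta> \<noteq> 0" if "\<beta> \<in> region []" for \<beta>
  proof -
    have "Re (\<beta> $ k) < 0" using that by (auto simp: region_def)
    hence "\<beta> $ k \<noteq> 0" by auto
    thus ?thesis using h0 region_Nil_shift[OF that] fin by (auto simp: h'_def)
  qed
  moreover have "cont (k # ks) \<beta> = g' \<beta> / h' \<beta>" if \<beta>: "\<beta> \<in> region (k # ks)" "h' \<beta> \<noteq> 0" for \<beta>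
  proof -
    have nz: "h (\<beta> - complex_vec (A l)) \<noteq> 0" if "l \<in> L" for l
      using \<beta>(2) that fin by (auto simp: h'_def)
    have "c l k * cont ks (\<beta> - complex_vec (A l)) =
        c l k * g (\<beta> - complex_vec (A l)) * (\<Prod>m\<in>L - {l}. h (\<beta> - complex_vec (A m))) / (\<Prod>m\<in>L. h (\<beta> - complex_vec (A m)))"
      if "l \<in> L" for l
    proof (cases "c l k = 0")
      case False
      have "(\<Prod>m\<in>L. h (\<beta> - complex_vec (A m))) = h (\<beta> - complex_vec (A l)) * (\<Prod>m\<in>L - {l}. h (\<beta> - complex_vec (A m)))"
        using fin that by (rule prod.remove)
      moreover have "(\<Prod>m\<in>L - {l}. h (\<beta> - complex_vec (A m))) \<noteq> 0" using nz fin by simp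
      ultimately show ?thesis
        using gh[OF region_Cons_shift[OF \<beta>(1) that False] nz[OF that]] nz[OF that]
        by (simp add: field_simps)
    qed simp
    hence "(\<Sum>l\<in>L. c l k * cont ks (\<beta> - complex_vec (A l))) = g' \<beta> / (\<Prod>m\<in>L. h (\<beta> - complex_vec (A m)))"
      by (simp add: g'_def sum_divide_distrib)
    thus ?thesis by (simp add: cont_simps step_def h'_def field_simps)
  qed
  ultimately show ?case by blast
qed

theorem continuation:
  "\<exists>F. F meromorphic_on_vec UNIV \<and> F holomorphic_on_vec (- P) \<and>
     (\<forall>\<beta>. (\<forall>k. Re (\<beta> $ k) < 0) \<longrightarrow> F \<beta> = G \<beta>)"
proof -
  \<comment> \<open>Each repetition of a word containing all directions raises every bound by at
    least \<open>mesh\<close>, so the regions of \<open>ks N\<close> exhaust the space.\<close>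
  obtain ks0 :: "'d list" where ks0: "set ks0 = UNIV" using finite_list[OF finite] by blast
  define ks where "ks N = concat (replicate N ks0)" for N
  have ks_add: "ks (N + M) = ks N @ ks M" for N M
    by (simp add: ks_def replicate_add)
  have count: "count_list (ks N) k \<ge> N" for N k
  proof (induction N)
    case (Suc N)
    have "count_list ks0 k \<noteq> 0" using ks0 by (simp add: count_list_0_iff)
    thus ?case using Suc by (simp add: ks_def)
  qed simp
  have ex: "\<exists>N. \<beta> \<in> region (ks N)" for \<beta>
  proof -
    obtain N :: nat where N: "(\<Sum>k\<in>UNIV. \<bar>Re (\<beta> $ k)\<bar>) / mesh < real N"
      using reals_Archimedean2 by blast
    have "Re (\<beta> $ k) < mesh * real (count_list (ks N) k)" for k
    proof -
      have "Re (\<beta> $ k) \<le> \<bar>Re (\<beta> $ k)\<bar>" by simp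
      also have "\<dots> \<le> (\<Sum>k\<in>UNIV. \<bar>Re (\<beta> $ k)\<bar>)" by (rule member_le_sum) auto
      also have "\<dots> < mesh * real N" using N mesh_pos by (simp add: field_simps)
      also have "\<dots> \<le> mesh * real (count_list (ks N) k)" using count mesh_pos by simp
      finally show ?thesis .
    qed
    thus ?thesis by (auto simp: region_def)
  qed
  \<comment> \<open>For \<open>M \<le> N\<close> the word \<open>ks M\<close> is a prefix of
    \<open>ks N\<close>, so \<open>cont_append\<close> shows that any admissible \<open>N\<close>
    gives the same value as the least one.\<close>
  define F where "F \<beta> = cont (ks (LEAST N. \<beta> \<in> region (ks N))) \<beta>" for \<beta>
  have F: "F \<beta> = cont (ks N) \<beta>" if "\<beta> \<in> region (ks N)" for \<beta> N
  proof -
    define M where "M = (LEAST N. \<beta> \<in> region (ks N))"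
    have "\<beta> \<in> region (ks M)" unfolding M_def using that by (rule LeastI)
    moreover have "M \<le> N" unfolding M_def using that by (rule Least_le)
    ultimately show ?thesis
      using cont_append[of \<beta> "ks M" "ks (N - M)"] ks_add[of M "N - M"] by (simp add: F_def M_def)
  qed
  have "F holomorphic_on_vec (- P)"
  proof -
    have "F holomorphic_on_vec (region (ks N) - P)" for N
      using holomorphic_on_vec_transform[OF cont_holomorphic open_region[of "ks N"]] F by force
    thus ?thesis using ex unfolding holomorphic_on_vec_def by (metis Compl_iff Diff_iff)
  qed
  moreover have "F meromorphic_on_vec UNIV"
    unfolding meromorphic_on_vec_def
  proof
    fix z :: "complex ^ 'd"
    obtain N where N: "z \<in> region (ks N)" using ex by blast
    obtain g h where "g holomorphic_on_vec (region (ks N))" "h holomorphic_on_vec UNIV"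
      "\<forall>\<beta>\<in>region []. h \<beta> \<noteq> 0" "\<forall>\<beta>\<in>region (ks N). h \<beta> \<noteq> 0 \<longrightarrow> cont (ks N) \<beta> = g \<beta> / h \<beta>"
      using cont_quotient by blast
    \<comment> \<open>The whole region serves as the neighbourhood \<open>V\<close>. This point of
      \<open>region []\<close> lies in it and witnesses that \<open>h\<close> is not identically
      zero there.\<close>
    moreover have "(\<chi> k. - 1) \<in> region []" by (simp add: region_def)
    hence "(\<chi> k. - 1) \<in> region (ks N)" using region_Nil_subset by blast
    ultimately show "\<exists>V g h. open V \<and> connected V \<and> z \<in> V \<and> V \<subseteq> UNIV \<and>
        g holomorphic_on_vec V \<and> h holomorphic_on_vec V \<and> (\<exists>w\<in>V. h w \<noteq> 0) \<and>
        (\<forall>w\<in>V. h w \<noteq> 0 \<longrightarrow> F w = g w / h w)"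
      using N F open_region connected_region holomorphic_on_vec_subset[of h UNIV]
        \<open>(\<chi> k. - 1) \<in> region []\<close>
      by (intro exI[of _ "region (ks N)"] exI[of _ g] exI[of _ h] conjI bexI[of _ "\<chi> k. - 1"]) auto
  qed
  \<comment> \<open>\<open>ks 0\<close> is the empty word, for which \<open>cont\<close> is
    \<open>G\<close> itself.\<close>
  moreover have "F \<beta> = G \<beta>" if "\<forall>k. Re (\<beta> $ k) < 0" for \<beta>
    using that F[of \<beta> 0] by (simp add: ks_def cont_simps region_def)
  ultimately show ?thesis by blast
qed

end

section \<open>Majorants on the orthant\<close>

text \<open>According to the sign of ln x the integrand is the Gamma integrand with parameter b +
  \<eta> or b - \<eta>, both positive. The weight exp(\<eta> |ln x|) is a reserve for the logarithms
  that appear on differentiating in \<beta>.\<close>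

lemma nn_integral_Gamma_majorant:
  fixes \<eta> b \<epsilon> :: real
  assumes "0 \<le> \<eta>" "\<eta> < b" "0 < \<epsilon>"
  shows "(\<integral>\<^sup>+x. ennreal (indicator {0<..} x * exp (\<eta> * \<bar>ln x\<bar> + (b - 1) * ln x - \<epsilon> * x)) \<partial>lborel) < \<infinity>"
proof -
  define h where "h c x = indicator {0<..} x * exp ((c - 1) * ln x - \<epsilon> * x)" for c x :: real
  have [measurable]: "h c \<in> borel_measurable borel" for c unfolding h_def by measurable
  have h: "integrable lborel (h c)" if "c > 0" for c
  proof -
    have "integrable lebesgue (\<lambda>x. norm (indicator {0<..} x *\<^sub>R
        (complex_of_real x powr (complex_of_real c - 1) / of_real (exp (\<epsilon> * x)))))"
      using absolutely_integrable_Gamma_integral[of "complex_of_real c" \<epsilon>] that assms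
      by (intro integrable_norm) (auto simp: set_integrable_def)
    also have "(\<lambda>x. norm (indicator {0<..} x *\<^sub>R
        (complex_of_real x powr (complex_of_real c - 1) / of_real (exp (\<epsilon> * x))))) = h c"
    proof
      fix x :: real
      show "norm (indicator {0<..} x *\<^sub>R
        (complex_of_real x powr (complex_of_real c - 1) / of_real (exp (\<epsilon> * x)))) = h c x"
        by (cases "x > 0")
           (auto simp: h_def norm_divide norm_powr_real_powr powr_def exp_diff simp flip: exp_of_real)
    qed
    \<comment> \<open>The Gamma integral is taken over the completed measure; for a Borel function
      integrability is the same over \<open>lborel\<close>.\<close>
    finally show ?thesis by (subst (asm) integrable_completion) auto
  qed
  have "integrable lborel (\<lambda>x. h (b + \<eta>) x + h (b - \<eta>) x)"
    using assms by (intro Bochner_Integration.integrable_add h) auto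
  hence fin: "(\<integral>\<^sup>+x. ennreal (norm (h (b + \<eta>) x + h (b - \<eta>) x)) \<partial>lborel) < \<infinity>"
    by (simp add: integrable_iff_bounded)
  have "indicator {0<..} x * exp (\<eta> * \<bar>ln x\<bar> + (b - 1) * ln x - \<epsilon> * x)
      \<le> norm (h (b + \<eta>) x + h (b - \<eta>) x)" for x
    by (cases "x > 0"; cases "ln x \<ge> 0") (auto simp: h_def algebra_simps)
  hence "(\<integral>\<^sup>+x. ennreal (indicator {0<..} x * exp (\<eta> * \<bar>ln x\<bar> + (b - 1) * ln x - \<epsilon> * x)) \<partial>lborel)
     \<le> (\<integral>\<^sup>+x. ennreal (norm (h (b + \<eta>) x + h (b - \<eta>) x)) \<partial>lborel)"
    by (intro nn_integral_mono ennreal_leI)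
  thus ?thesis using fin by (rule le_less_trans)
qed

section \<open>Integration over the positive orthant\<close>

lemma pos_orthant_measurable [measurable]: "(pos_orthant :: (real ^ 'd) set) \<in> sets borel"
proof -
  have eq: "pos_orthant = (\<Inter>k. {r::real ^ 'd. 0 < r $ k})" by (auto simp: pos_orthant_def)
  have "open (pos_orthant :: (real ^ 'd) set)"
    unfolding eq by (intro open_INT ballI open_Collect_less continuous_intros) simp
  thus ?thesis by simp
qed

lemma vec_nth_measurable [measurable]: "(\<lambda>r::real ^ 'd. r $ k) \<in> borel_measurable borel"
  by (intro borel_measurable_continuous_onI continuous_intros)

definition orthant_measure :: "(real ^ 'd) measure" where
  "orthant_measure = restrict_space lborel pos_orthant"

lemma space_orthant_measure: "space orthant_measure = pos_orthant"
  by (simp add: orthant_measure_def space_restrict_space)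

lemma measurable_orthant_measure:
  "f \<in> borel_measurable borel \<Longrightarrow> f \<in> borel_measurable orthant_measure"
  unfolding orthant_measure_def by (rule measurable_restrict_space1) simp

lemma integrable_orthant_measure:
  fixes f :: "real ^ 'd \<Rightarrow> 'b::{banach, second_countable_topology}"
  shows "integrable orthant_measure f \<longleftrightarrow> set_integrable lborel pos_orthant f"
  unfolding orthant_measure_def set_integrable_def by (rule integrable_restrict_space) simp

lemma integral_orthant_measure:
  fixes f :: "real ^ 'd \<Rightarrow> 'b::{banach, second_countable_topology}"
  shows "integral\<^sup>L orthant_measure f = (LINT r:pos_orthant|lborel. f r)"
  unfolding orthant_measure_def set_lebesgue_integral_def by (rule integral_restrict_space) simp

lemma prod_Basis_vec:
  fixes f :: "real ^ 'd \<Rightarrow> 'c::comm_monoid_mult"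
  shows "(\<Prod>b\<in>Basis. f b) = (\<Prod>k\<in>UNIV. f (axis k 1))"
proof -
  have "Basis = range (\<lambda>k::'d. axis k (1::real))" by (auto simp: Basis_vec_def)
  hence "prod f Basis = prod f (range (\<lambda>k::'d. axis k (1::real)))" by (rule arg_cong)
  also have "\<dots> = (\<Prod> k\<in>UNIV. f (axis k 1))"
    by (subst prod.reindex) (auto simp: inj_def axis_eq_axis)
  finally show ?thesis .
qed

lemma sum_Basis_vec:
  fixes f :: "real ^ 'd \<Rightarrow> 'c::comm_monoid_add"
  shows "(\<Sum>b\<in>Basis. f b) = (\<Sum>k\<in>UNIV. f (axis k 1))"
proof -
  have "Basis = range (\<lambda>k::'d. axis k (1::real))" by (auto simp: Basis_vec_def)
  hence "sum f Basis = sum f (range (\<lambda>k::'d. axis k (1::real)))" by (rule arg_cong)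
  also have "\<dots> = (\<Sum> k\<in>UNIV. f (axis k 1))"
    by (subst sum.reindex) (auto simp: inj_def axis_eq_axis)
  finally show ?thesis .
qed

text \<open>A product of one-variable Gamma integrands with parameters b_k, each carrying the
  reserve weight exp(\<eta> |ln r_k|).\<close>

definition majorant :: "real \<Rightarrow> real ^ 'd \<Rightarrow> real \<Rightarrow> real ^ 'd \<Rightarrow> real" where
  "majorant \<eta> b \<epsilon> r = exp (\<Sum>k\<in>UNIV. \<eta> * \<bar>ln (r $ k)\<bar> + (b $ k - 1) * ln (r $ k) - \<epsilon> * r $ k)"

lemma integrable_majorant:
  fixes b :: "real ^ 'd"
  assumes "0 \<le> \<eta>" "\<And>k. \<eta> < b $ k" "0 < \<epsilon>"
  shows "integrable orthant_measure (majorant \<eta> b \<epsilon>)"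
proof -
  \<comment> \<open>Each factor carries its own indicator, so that the product includes the
    indicator of the orthant and Tonelli's theorem separates the coordinates.\<close>
  define f where "f j x = indicator {0<..} x * exp (\<eta> * \<bar>ln x\<bar> + (b \<bullet> j - 1) * ln x - \<epsilon> * x)"
    for j :: "real ^ 'd" and x :: real
  have [measurable]: "f j \<in> borel_measurable borel" for j unfolding f_def by measurable
  have [measurable]: "majorant \<eta> b \<epsilon> \<in> borel_measurable borel"
    unfolding majorant_def by measurable
  have eq: "indicator pos_orthant r * majorant \<eta> b \<epsilon> r = (\<Prod>j\<in>Basis. f j (r \<bullet> j))" for r :: "real ^ 'd"
  proof (cases "r \<in> pos_orthant")
    case True
    thus ?thesis
      by (simp add: prod_Basis_vec f_def inner_axis majorant_def exp_sum pos_orthant_def)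
  next
    case False
    then obtain k where "\<not> r $ k > 0" by (auto simp: pos_orthant_def)
    hence "f (axis k 1) (r \<bullet> axis k 1) = 0" by (simp add: f_def inner_axis)
    hence "(\<Prod>k\<in>UNIV. f (axis k 1) (r \<bullet> axis k 1)) = 0" by (auto intro!: prod_zero)
    thus ?thesis using False by (simp add: prod_Basis_vec)
  qed
  have "(\<integral>\<^sup>+r. ennreal (norm (indicator pos_orthant r *\<^sub>R majorant \<eta> b \<epsilon> r)) \<partial>lborel)
      = (\<integral>\<^sup>+r. (\<Prod>j\<in>Basis. ennreal (f j (r \<bullet> j))) \<partial>lborel)"
  proof (intro nn_integral_cong)
    fix r :: "real ^ 'd"
    have "norm (indicator pos_orthant r *\<^sub>R majorant \<eta> b \<epsilon> r) = indicator pos_orthant r * majorant \<eta> b \<epsilon> r"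
      by (simp add: majorant_def)
    thus "ennreal (norm (indicator pos_orthant r *\<^sub>R majorant \<eta> b \<epsilon> r)) = (\<Prod>j\<in>Basis. ennreal (f j (r \<bullet> j)))"
      by (simp only: eq) (subst prod_ennreal, auto simp: f_def)
  qed
  also have "\<dots> = (\<Prod>j\<in>Basis. \<integral>\<^sup>+x. ennreal (f j x) \<partial>lborel)"
    by (rule nn_integral_lborel_prod) auto
  also have "\<dots> < \<infinity>"
  proof -
    have "(\<integral>\<^sup>+x. ennreal (f (axis k 1) x) \<partial>lborel) < \<infinity>" for k
      using nn_integral_Gamma_majorant[OF assms(1) assms(2)[of k] assms(3)]
      by (simp add: f_def inner_axis)
    thus ?thesis by (auto simp: prod_Basis_vec less_top[symmetric] ennreal_prod_eq_top)
  qed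
  finally show ?thesis
    unfolding integrable_orthant_measure set_integrable_def by (intro integrableI_bounded) auto
qed

text \<open>A diagonal change of variables. Writing the factor as \<open>exp x\<close> leaves the
  orthant invariant and gives a family of scalings through the identity at x = 0.\<close>

lemma integral_orthant_scale:
  fixes f :: "real ^ 'd \<Rightarrow> complex"
  assumes [measurable]: "f \<in> borel_measurable borel"
  shows "(\<integral>r. f (\<chi> i. if i = k then exp x * r $ i else r $ i) \<partial>orthant_measure) =
    of_real (exp (- x)) * (\<integral>r. f r \<partial>orthant_measure)"
proof -
  define S where "S r = (\<chi> i. if i = k then exp x * r $ i else r $ i)" for r :: "real ^ 'd"
  define c where "c j = (if j = axis k 1 then exp x else 1)" for j :: "real ^ 'd"
  have S: "(\<lambda>r. 0 + (\<Sum>j\<in>Basis. (c j * (r \<bullet> j)) *\<^sub>R j)) = S"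
  proof
    fix r :: "real ^ 'd"
    have "(\<Sum>j\<in>Basis. (c j * (r \<bullet> j)) *\<^sub>R j) $ i = S r $ i" for i
    proof -
      have "(\<Sum>j\<in>Basis. (c j * (r \<bullet> j)) *\<^sub>R j) $ i =
          (\<Sum>m\<in>UNIV. (if m = i then c (axis m 1) * (r $ m) else 0))"
        unfolding sum_component sum_Basis_vec
        by (rule sum.cong) (simp_all add: inner_axis, simp add: axis_def)
      thus ?thesis by (simp add: c_def S_def axis_eq_axis)
    qed
    thus "0 + (\<Sum>j\<in>Basis. (c j * (r \<bullet> j)) *\<^sub>R j) = S r" by (simp add: vec_eq_iff)
  qed
  have "(\<Prod>j\<in>Basis. \<bar>c j\<bar>) = (\<Prod>m\<in>UNIV. if m = k then exp x else 1)"
    unfolding prod_Basis_vec by (intro prod.cong) (auto simp: c_def axis_eq_axis)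
  hence prod: "(\<Prod>j\<in>Basis. \<bar>c j\<bar>) = exp x" by simp
  have lb: "lborel = density (distr lborel borel S) (\<lambda>_. ennreal (exp x))"
    using lborel_affine_euclidean[of c 0] unfolding S prod by (auto simp: c_def)
  have [measurable]: "S \<in> borel_measurable borel"
    unfolding S[symmetric] by measurable
  have "(\<integral>r. f r \<partial>orthant_measure) = (\<integral>r. indicator pos_orthant r *\<^sub>R f r \<partial>lborel)"
    by (simp add: integral_orthant_measure set_lebesgue_integral_def)
  also have "\<dots> = (\<integral>r. exp x *\<^sub>R (indicator pos_orthant (S r) *\<^sub>R f (S r)) \<partial>lborel)"
    by (subst lb, subst integral_density) (auto simp: integral_distr)
  also have "\<dots> = exp x *\<^sub>R (\<integral>r. indicator pos_orthant (S r) *\<^sub>R f (S r) \<partial>lborel)"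
    by (rule integral_scaleR_right)
  also have "(\<lambda>r. indicator pos_orthant (S r) *\<^sub>R f (S r)) = (\<lambda>r. indicator pos_orthant r *\<^sub>R f (S r))"
  proof -
    have "S r \<in> pos_orthant \<longleftrightarrow> r \<in> pos_orthant" for r
      by (auto simp: S_def pos_orthant_def zero_less_mult_iff)
    thus ?thesis by (auto simp: indicator_def)
  qed
  also have "(\<integral>r. indicator pos_orthant r *\<^sub>R f (S r) \<partial>lborel) = (\<integral>r. f (S r) \<partial>orthant_measure)"
    by (simp add: integral_orthant_measure set_lebesgue_integral_def)
  finally show ?thesis
    by (simp add: S_def[abs_def] exp_minus scaleR_conv_of_real)
qed

section \<open>Monomials on the universal covering\<close>

lemma cover_powr_add: "cover_powr r \<theta> (v + w) = cover_powr r \<theta> v * cover_powr r \<theta> w"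
  by (simp add: cover_powr_def algebra_simps sum.distrib flip: exp_add)

lemma norm_cover_powr:
  "norm (cover_powr r \<theta> v) = exp (\<Sum>k\<in>UNIV. Re (v $ k) * ln (r $ k) - Im (v $ k) * \<theta> $ k)"
  by (simp add: cover_powr_def)

lemma cover_powr_scale:
  assumes "r \<in> pos_orthant"
  shows "cover_powr (\<chi> i. if i = k then exp x * r $ i else r $ i) \<theta> v =
    exp (v $ k * of_real x) * cover_powr r \<theta> v"
proof -
  have "(\<Sum>i\<in>UNIV. v $ i * (complex_of_real (ln (if i = k then exp x * r $ i else r $ i)) + \<i> * complex_of_real (\<theta> $ i)))
    = (\<Sum>i\<in>UNIV. v $ i * (complex_of_real (ln (r $ i)) + \<i> * complex_of_real (\<theta> $ i)) + (if i = k then v $ k * of_real x else 0))"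
    using assms by (intro sum.cong) (auto simp: pos_orthant_def ln_mult_pos algebra_simps)
  thus ?thesis by (simp add: cover_powr_def sum.distrib exp_add)
qed

lemma measurable_cover_powr [measurable]: "(\<lambda>r. cover_powr r \<theta> v) \<in> borel_measurable borel"
  unfolding cover_powr_def by measurable

section \<open>Mellin transforms of exponential sums\<close>

text \<open>The linear terms t_1 + ... + t_d will be among the summands, as monomials of the unit
  columns, so that all columns are treated alike. \<open>decay\<close> isolates what the conditions
  on angles, degrees and sector have to supply.\<close>

locale exponential_sum =
  fixes L :: "'l set" and A :: "'l \<Rightarrow> real ^ 'd::finite" and C :: "'l \<Rightarrow> complex"
    and \<theta> :: "real ^ 'd" and \<epsilon> M :: real
  assumes fin: "finite L"
    and nonneg: "l \<in> L \<Longrightarrow> 0 \<le> A l $ k"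
    and eps: "0 < \<epsilon>"
    and decay: "r \<in> pos_orthant \<Longrightarrow>
      norm (exp (\<Sum>l\<in>L. C l * cover_powr r \<theta> (complex_vec (A l))))
        \<le> M * exp (- \<epsilon> * (\<Sum>k\<in>UNIV. r $ k))"
begin

definition E :: "real ^ 'd \<Rightarrow> complex" where
  "E r = exp (\<Sum>l\<in>L. C l * cover_powr r \<theta> (complex_vec (A l)))"

text \<open>The Mellin kernel without the constant factor of dt, which is restored in the
  theorem.\<close>

definition K :: "complex ^ 'd \<Rightarrow> real ^ 'd \<Rightarrow> complex" where
  "K \<beta> r = cover_powr r \<theta> (- \<beta> - 1) * E r"

definition mellin :: "complex ^ 'd \<Rightarrow> complex" where
  "mellin \<beta> = (\<integral>r. K \<beta> r \<partial>orthant_measure)"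

lemma E_measurable [measurable]: "E \<in> borel_measurable borel"
  unfolding E_def by measurable

lemma K_measurable [measurable]: "K \<beta> \<in> borel_measurable borel"
  unfolding K_def by measurable

lemma E_bound: "r \<in> pos_orthant \<Longrightarrow> norm (E r) \<le> M * exp (- \<epsilon> * (\<Sum>k\<in>UNIV. r $ k))"
  using decay by (simp add: E_def)

lemma M_nonneg: "0 \<le> M"
proof -
  have "(1 :: real ^ 'd) \<in> pos_orthant" by (simp add: pos_orthant_def)
  from E_bound[OF this] have "0 \<le> M * exp (- \<epsilon> * (\<Sum>k\<in>UNIV. (1 :: real ^ 'd) $ k))"
    by (rule order_trans[OF norm_ge_zero])
  thus ?thesis by (simp add: zero_le_mult_iff)
qed

text \<open>The sum of |log t_k| along the cycle. It dominates each logarithm produced by a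
  derivative of t^(-\<beta>) in \<beta>.\<close>

definition logs :: "real ^ 'd \<Rightarrow> real" where
  "logs r = (\<Sum>k\<in>UNIV. norm (complex_of_real (ln (r $ k)) + \<i> * complex_of_real (\<theta> $ k)))"

lemma logs_nonneg: "0 \<le> logs r"
  by (simp add: logs_def sum_nonneg)

lemma logs_measurable [measurable]: "logs \<in> borel_measurable borel"
  unfolding logs_def by measurable

text \<open>The angles are constant on the cycle, so they contribute only a constant factor; the
  power -\<beta> - 1 has modulus of Gamma type with parameters -Re \<beta>_k.\<close>

lemma exp_logs_bound:
  assumes "0 \<le> \<eta>"
  shows "exp (\<eta> * logs r) * (norm (cover_powr r \<theta> (- \<beta> - 1)) * exp (- \<epsilon> * (\<Sum>k\<in>UNIV. r $ k)))
    \<le> exp (\<Sum>k\<in>UNIV. \<eta> * \<bar>\<theta> $ k\<bar> + Im (\<beta> $ k) * \<theta> $ k) * majorant \<eta> (\<chi> k. - Re (\<beta> $ k)) \<epsilon> r"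
proof -
  have "\<eta> * logs r \<le> (\<Sum>k\<in>UNIV. \<eta> * (\<bar>ln (r $ k)\<bar> + \<bar>\<theta> $ k\<bar>))"
    unfolding logs_def sum_distrib_left using assms
    by (intro sum_mono mult_left_mono order_trans[OF norm_triangle_ineq]) (auto simp: norm_mult)
  hence "exp (\<eta> * logs r + ((\<Sum>k\<in>UNIV. Re ((- \<beta> - 1) $ k) * ln (r $ k) - Im ((- \<beta> - 1) $ k) * \<theta> $ k)
        + - \<epsilon> * (\<Sum>k\<in>UNIV. r $ k)))
    \<le> exp ((\<Sum>k\<in>UNIV. \<eta> * (\<bar>ln (r $ k)\<bar> + \<bar>\<theta> $ k\<bar>)) +
        ((\<Sum>k\<in>UNIV. Re ((- \<beta> - 1) $ k) * ln (r $ k) - Im ((- \<beta> - 1) $ k) * \<theta> $ k)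
        + - \<epsilon> * (\<Sum>k\<in>UNIV. r $ k)))"
    by simp
  also have "(\<Sum>k\<in>UNIV. \<eta> * (\<bar>ln (r $ k)\<bar> + \<bar>\<theta> $ k\<bar>)) +
        ((\<Sum>k\<in>UNIV. Re ((- \<beta> - 1) $ k) * ln (r $ k) - Im ((- \<beta> - 1) $ k) * \<theta> $ k)
        + - \<epsilon> * (\<Sum>k\<in>UNIV. r $ k))
    = (\<Sum>k\<in>UNIV. \<eta> * \<bar>\<theta> $ k\<bar> + Im (\<beta> $ k) * \<theta> $ k) +
      (\<Sum>k\<in>UNIV. \<eta> * \<bar>ln (r $ k)\<bar> + ((\<chi> k. - Re (\<beta> $ k)) $ k - 1) * ln (r $ k) - \<epsilon> * r $ k)"
    unfolding sum_distrib_left sum.distrib[symmetric] by (intro sum.cong) (auto simp: algebra_simps)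
  finally show ?thesis by (simp only: exp_add norm_cover_powr majorant_def)
qed

lemma integrable_logs_cover:
  assumes "0 \<le> \<eta>" "\<And>k. \<eta> < - Re (\<beta> $ k)"
  shows "integrable orthant_measure
    (\<lambda>r. exp (\<eta> * logs r) * (norm (cover_powr r \<theta> (- \<beta> - 1)) * exp (- \<epsilon> * (\<Sum>k\<in>UNIV. r $ k))))"
proof (rule Bochner_Integration.integrable_bound)
  show "integrable orthant_measure (\<lambda>r. exp (\<Sum>k\<in>UNIV. \<eta> * \<bar>\<theta> $ k\<bar> + Im (\<beta> $ k) * \<theta> $ k) *
      majorant \<eta> (\<chi> k. - Re (\<beta> $ k)) \<epsilon> r)"
    using assms eps by (intro integrable_mult_right integrable_majorant) auto
  show "AE r in orthant_measure.
      norm (exp (\<eta> * logs r) * (norm (cover_powr r \<theta> (- \<beta> - 1)) * exp (- \<epsilon> * (\<Sum>k\<in>UNIV. r $ k))))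
      \<le> norm (exp (\<Sum>k\<in>UNIV. \<eta> * \<bar>\<theta> $ k\<bar> + Im (\<beta> $ k) * \<theta> $ k) * majorant \<eta> (\<chi> k. - Re (\<beta> $ k)) \<epsilon> r)"
    using exp_logs_bound[OF assms(1)] by (intro AE_I2) (simp add: majorant_def)
qed (intro measurable_orthant_measure; measurable)

text \<open>The test behind the integrability of the kernel (\<eta> = 0) and of its derivative and
  remainder bounds (\<eta> > 0). The room for \<eta> is the distance of Re \<beta>_k from 0.\<close>

lemma integrable_dominated:
  fixes f :: "real ^ 'd \<Rightarrow> 'b::{banach, second_countable_topology}"
  assumes "0 \<le> \<eta>" "\<And>k. \<eta> < - Re (\<beta> $ k)" "f \<in> borel_measurable borel"
    and f: "\<And>r. r \<in> pos_orthant \<Longrightarrow> norm (f r) \<le> B * exp (\<eta> * logs r) * norm (K \<beta> r)" and "0 \<le> B"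
  shows "integrable orthant_measure f"
proof (rule Bochner_Integration.integrable_bound)
  show "integrable orthant_measure (\<lambda>r. B * M * (exp (\<eta> * logs r) *
      (norm (cover_powr r \<theta> (- \<beta> - 1)) * exp (- \<epsilon> * (\<Sum>k\<in>UNIV. r $ k)))))"
    using assms by (intro integrable_mult_right integrable_logs_cover) auto
  show "AE r in orthant_measure. norm (f r) \<le> norm (B * M * (exp (\<eta> * logs r) *
      (norm (cover_powr r \<theta> (- \<beta> - 1)) * exp (- \<epsilon> * (\<Sum>k\<in>UNIV. r $ k)))))"
  proof (intro AE_I2)
    fix r :: "real ^ 'd" assume "r \<in> space orthant_measure"
    hence r: "r \<in> pos_orthant" by (simp add: space_orthant_measure)
    have "norm (f r) \<le> B * exp (\<eta> * logs r) * (norm (cover_powr r \<theta> (- \<beta> - 1)) * norm (E r))"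
      using f[OF r] by (simp add: K_def norm_mult)
    also have "\<dots> \<le> B * exp (\<eta> * logs r) *
        (norm (cover_powr r \<theta> (- \<beta> - 1)) * (M * exp (- \<epsilon> * (\<Sum>k\<in>UNIV. r $ k))))"
      using assms(5) E_bound[OF r] by (intro mult_left_mono) auto
    finally show "norm (f r) \<le> norm (B * M * (exp (\<eta> * logs r) *
      (norm (cover_powr r \<theta> (- \<beta> - 1)) * exp (- \<epsilon> * (\<Sum>k\<in>UNIV. r $ k)))))"
      using assms(5) M_nonneg by (simp add: abs_mult mult_ac)
  qed
qed (use assms in \<open>auto intro: measurable_orthant_measure\<close>)

lemma integrable_K: "(\<And>k. Re (\<beta> $ k) < 0) \<Longrightarrow> integrable orthant_measure (K \<beta>)"
  by (rule integrable_dominated[of 0 \<beta> _ 1]) auto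

lemma K_add: "K (\<beta> + h) r = K \<beta> r *
    exp (- (\<Sum>k\<in>UNIV. h $ k * (complex_of_real (ln (r $ k)) + \<i> * complex_of_real (\<theta> $ k))))"
  by (simp add: K_def cover_powr_def algebra_simps sum.distrib sum_negf sum_subtractf flip: exp_add)

text \<open>Differentiation under the integral by an explicit second-order remainder. With w = sum
  of h_k log t_k, the remainder of the kernel is at most |K| exp |w| |w|^2, and |w| \<le> |h| logs.
  The reserve weight makes this integrable, with a bound quadratic in |h|.\<close>

lemma mellin_holomorphic: "mellin holomorphic_on_vec {\<beta>. \<forall>k. Re (\<beta> $ k) < 0}"
  unfolding holomorphic_on_vec_def
proof
  fix \<beta> :: "complex ^ 'd" assume "\<beta> \<in> {\<beta>. \<forall>k. Re (\<beta> $ k) < 0}"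
  hence neg: "Re (\<beta> $ k) < 0" for k by blast
  define \<eta> where "\<eta> = Min (range (\<lambda>k. - Re (\<beta> $ k))) / 2"
  have Min_pos: "0 < Min (range (\<lambda>k. - Re (\<beta> $ k)))" using neg by (subst Min_gr_iff) auto
  hence \<eta>: "0 < \<eta>" by (simp add: \<eta>_def)
  have \<eta>_less: "\<eta> < - Re (\<beta> $ k)" for k
  proof -
    have "Min (range (\<lambda>k. - Re (\<beta> $ k))) \<le> - Re (\<beta> $ k)" by (rule Min_le) auto
    thus ?thesis using Min_pos unfolding \<eta>_def by linarith
  qed
  define lg where "lg r k = complex_of_real (ln (r $ k)) + \<i> * complex_of_real (\<theta> $ k)" for r k
  have [measurable]: "(\<lambda>r. lg r k) \<in> borel_measurable borel" for k unfolding lg_def by measurable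
  have lg_le: "norm (lg r k) \<le> logs r" for r k
    unfolding logs_def lg_def by (rule member_le_sum) auto
  \<comment> \<open>The constant \<open>1 / \<eta>\<close> comes from u \<le> exp u at u = \<eta> *
    logs r.\<close>
  have lgK: "integrable orthant_measure (\<lambda>r. lg r k * K \<beta> r)" for k
  proof (rule integrable_dominated[of \<eta> \<beta> _ "1 / \<eta>"])
    fix r
    have "\<eta> * logs r \<le> exp (\<eta> * logs r)" using exp_ge_add_one_self[of "\<eta> * logs r"] by linarith
    hence "norm (lg r k) \<le> 1 / \<eta> * exp (\<eta> * logs r)"
      using lg_le[of r k] \<eta> by (simp add: field_simps) (smt (verit) mult_left_mono)
    thus "norm (lg r k * K \<beta> r) \<le> 1 / \<eta> * exp (\<eta> * logs r) * norm (K \<beta> r)"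
      unfolding norm_mult by (intro mult_right_mono) auto
  qed (use \<eta> \<eta>_less in auto)
  \<comment> \<open>The integral of the derivative of t^(-\<beta>) in direction h, which brings down
    minus the sum of h_k log t_k.\<close>
  define D where "D h = - (\<Sum>k\<in>UNIV. h $ k * (\<integral>r. lg r k * K \<beta> r \<partial>orthant_measure))"
    for h :: "complex ^ 'd"
  have bl: "bounded_linear D"
    unfolding D_def
    by (intro bounded_linear_minus bounded_linear_sum bounded_linear_compose[OF bounded_linear_mult_left]
        bounded_linear_vec_nth)
  have wt: "integrable orthant_measure (\<lambda>r. exp (\<eta> * logs r) * norm (K \<beta> r))"
    by (rule integrable_dominated[of \<eta> \<beta> _ 1]) (use \<eta> \<eta>_less in auto)
  \<comment> \<open>With x = \<eta>/2 * logs r, the bound x^2 \<le> 2 exp x gives (logs r)^2 \<le>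
    8/\<eta>^2 * exp x.\<close>
  define B where "B = 8 / \<eta>\<^sup>2 * (\<integral>r. exp (\<eta> * logs r) * norm (K \<beta> r) \<partial>orthant_measure)"
  have remainder: "norm (mellin y - mellin \<beta> - D (y - \<beta>)) / norm (y - \<beta>) \<le> B * norm (y - \<beta>)"
    if y: "dist y \<beta> < \<eta> / 2" "y \<noteq> \<beta>" for y
  proof -
    define h where "h = y - \<beta>"
    have nh: "norm h < \<eta> / 2" using y by (simp add: h_def dist_norm)
    have comp: "norm (h $ k) \<le> norm h" for k by (rule Finite_Cartesian_Product.norm_nth_le)
    have "Re (y $ k) < 0" for k
      using comp[of k] nh \<eta>_less[of k] abs_Re_le_cmod[of "h $ k"] \<eta> by (simp add: h_def)
    hence Ky: "integrable orthant_measure (K y)" by (rule integrable_K)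
    define w where "w r = (\<Sum>k\<in>UNIV. h $ k * lg r k)" for r
    have w_K: "integrable orthant_measure (\<lambda>r. w r * K \<beta> r)"
      unfolding w_def sum_distrib_right mult.assoc
      by (intro Bochner_Integration.integrable_sum integrable_mult_right lgK)
    have "D h = - (\<integral>r. w r * K \<beta> r \<partial>orthant_measure)"
      unfolding w_def sum_distrib_right mult.assoc D_def
      by (subst Bochner_Integration.integral_sum)
         (simp_all add: lgK)
    hence "mellin y - mellin \<beta> - D h = (\<integral>r. K y r - K \<beta> r + w r * K \<beta> r \<partial>orthant_measure)"
      unfolding mellin_def using Ky integrable_K[OF neg] w_K by simp
    moreover have "norm (\<integral>r. K y r - K \<beta> r + w r * K \<beta> r \<partial>orthant_measure)
        \<le> (\<integral>r. (8 / \<eta>\<^sup>2 * (norm h)\<^sup>2) * (exp (\<eta> * logs r) * norm (K \<beta> r)) \<partial>orthant_measure)"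
    proof (rule Bochner_Integration.integral_norm_bound_integral)
      fix r
      have "K y r = K \<beta> r * exp (- w r)"
        using K_add[of \<beta> h r] by (simp add: h_def w_def lg_def)
      \<comment> \<open>The sum is the first Taylor polynomial 1 - w of exp(-w).\<close>
      hence "K y r - K \<beta> r + w r * K \<beta> r = K \<beta> r * (exp (- w r) - (\<Sum>i\<le>1. (- w r) ^ i / fact i))"
        by (simp add: algebra_simps)
      hence "norm (K y r - K \<beta> r + w r * K \<beta> r)
          \<le> norm (K \<beta> r) * (exp (norm (w r)) * norm (w r) ^ 2)"
        using Taylor_exp_field[of "- w r" 1] by (simp add: norm_mult mult_left_mono numeral_2_eq_2)
      also have "\<dots> \<le> norm (K \<beta> r) * (8 / \<eta>\<^sup>2 * (norm h)\<^sup>2 * exp (\<eta> * logs r))"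
      proof (intro mult_left_mono norm_ge_zero)
        have w_le: "norm (w r) \<le> norm h * logs r"
        proof -
          have "norm (w r) \<le> (\<Sum>k\<in>UNIV. norm h * norm (lg r k))"
            unfolding w_def using comp by (intro sum_norm_le) (auto simp: norm_mult mult_right_mono)
          thus ?thesis by (simp add: logs_def lg_def sum_distrib_left)
        qed
        also have "\<dots> \<le> \<eta> / 2 * logs r"
          using nh logs_nonneg by (intro mult_right_mono) auto
        finally have 1: "exp (norm (w r)) \<le> exp (\<eta> / 2 * logs r)" by simp
        define x where "x = \<eta> / 2 * logs r"
        have x: "0 \<le> x" using \<eta> logs_nonneg by (simp add: x_def)
        have "x\<^sup>2 \<le> 2 * exp x" using exp_lower_Taylor_quadratic[OF x] x by simp
        hence "(logs r)\<^sup>2 \<le> 8 / \<eta>\<^sup>2 * exp x" using \<eta> by (simp add: x_def field_simps power2_eq_square)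
        hence 2: "(norm (w r))\<^sup>2 \<le> (norm h)\<^sup>2 * (8 / \<eta>\<^sup>2 * exp x)"
          using power_mono[OF w_le norm_ge_zero, of 2] 
          by (smt (verit) mult_left_mono power_mult_distrib zero_le_power2)
        \<comment> \<open>Half of the weight exp(2x) = exp(\<eta> * logs r) pays for exp |w|, the
          other half for |w|^2.\<close>
        have "exp (norm (w r)) * (norm (w r))\<^sup>2 \<le> exp x * ((norm h)\<^sup>2 * (8 / \<eta>\<^sup>2 * exp x))"
          using 1 2 by (intro mult_mono) (auto simp: x_def)
        also have "\<dots> = 8 / \<eta>\<^sup>2 * (norm h)\<^sup>2 * exp (x + x)" by (simp only: exp_add mult_ac)
        also have "x + x = \<eta> * logs r" by (simp add: x_def)
        finally show "exp (norm (w r)) * (norm (w r))\<^sup>2 \<le> 8 / \<eta>\<^sup>2 * (norm h)\<^sup>2 * exp (\<eta> * logs r)" .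
      qed
      finally show "norm (K y r - K \<beta> r + w r * K \<beta> r)
          \<le> (8 / \<eta>\<^sup>2 * (norm h)\<^sup>2) * (exp (\<eta> * logs r) * norm (K \<beta> r))"
        by (simp add: mult_ac)
    qed (use Ky integrable_K[OF neg] w_K wt in auto)
    ultimately have "norm (mellin y - mellin \<beta> - D h) \<le> B * (norm h)\<^sup>2"
      by (simp add: B_def mult_ac)
    moreover have "norm h > 0" using y by (simp add: h_def)
    ultimately show ?thesis by (simp add: h_def[symmetric] field_simps power2_eq_square)
  qed
  have "(mellin has_derivative D) (at \<beta>)"
  proof (rule has_derivativeI_sandwich[of "\<eta> / 2" D UNIV \<beta> mellin "\<lambda>y. B * norm (y - \<beta>)"])
    show "((\<lambda>y. B * norm (y - \<beta>)) \<longlongrightarrow> 0) (at \<beta>)"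
      by (auto intro!: tendsto_eq_intros)
  qed (use \<eta> bl remainder in auto)
  moreover have "D (c *s v) = c * D v" for c v
    unfolding D_def vector_smult_component mult_minus_right sum_distrib_left mult.assoc ..
  ultimately show "\<exists>D. (mellin has_derivative D) (at \<beta>) \<and> (\<forall>c v. D (c *s v) = c * D v)"
    by blast
qed

text \<open>The derivative at x = 0 of the integral \<open>J x\<close> is found twice. Substitution
  gives J x = exp(\<beta>_k x) times the Mellin integral, hence the left side. Under the integral
  sign, scaling t_k multiplies the monomial of column l by exp(A_lk x), so its derivative brings
  down A_lk C_l t^(A l), hence the right side.\<close>

lemma mellin_equation:
  assumes neg: "\<And>j. Re (\<beta> $ j) < 0"
  shows "\<beta> $ k * mellin \<beta> = (\<Sum>l\<in>L. (of_real (A l $ k) * C l) * mellin (\<beta> - complex_vec (A l)))"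
proof -
  \<comment> \<open>Dominated convergence needs a sequence; these increments lie in ]0,1], where the
    bounds below hold.\<close>
  define X where "X m = inverse (real (Suc m))" for m
  define S where "S x r = (\<chi> i. if i = k then exp x * r $ i else r $ i)" for x and r :: "real ^ 'd"
  define J where "J x = (\<integral>r. cover_powr r \<theta> (- \<beta> - 1) * E (S x r) \<partial>orthant_measure)" for x
  have [measurable]: "S x \<in> borel_measurable borel" for x
  proof -
    have "continuous_on UNIV (\<lambda>r::real ^ 'd. if i = k then exp x * r $ i else r $ i)" for i
      by (cases "i = k") (auto intro!: continuous_intros)
    thus ?thesis unfolding S_def by (intro borel_measurable_continuous_onI continuous_on_vec_lambda)
  qed
  have S_pos: "S x r \<in> pos_orthant" if "r \<in> pos_orthant" for x r
    using that by (auto simp: S_def pos_orthant_def)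
  \<comment> \<open>Scaling the power as well costs exp(-(\<beta>_k + 1) x), which is compensated
    here. Together with the Jacobian exp(-x) this leaves exp(\<beta>_k x) in
    \<open>J\<close>.\<close>
  have K_S: "cover_powr r \<theta> (- \<beta> - 1) * E (S x r) = exp ((\<beta> $ k + 1) * of_real x) * K \<beta> (S x r)"
    if "r \<in> pos_orthant" for x r
  proof -
    have "exp ((\<beta> $ k + 1) * of_real x) * exp ((- \<beta> - 1) $ k * of_real x) = 1"
      unfolding exp_add[symmetric] by (simp add: algebra_simps)
    thus ?thesis unfolding K_def S_def cover_powr_scale[OF that] by (simp flip: mult.assoc)
  qed
  have J: "J x = exp (\<beta> $ k * of_real x) * mellin \<beta>" for x
  proof -
    have "J x = (\<integral>r. exp ((\<beta> $ k + 1) * of_real x) * K \<beta> (S x r) \<partial>orthant_measure)"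
      unfolding J_def by (intro Bochner_Integration.integral_cong) (auto simp: space_orthant_measure K_S)
    also have "\<dots> = exp ((\<beta> $ k + 1) * of_real x) * (of_real (exp (- x)) * mellin \<beta>)"
      using integral_orthant_scale[of "K \<beta>" k x] by (simp add: mellin_def S_def)
    also have "\<dots> = exp ((\<beta> $ k + 1) * of_real x + of_real (- x)) * mellin \<beta>"
      by (simp only: exp_add exp_of_real mult.assoc)
    finally show ?thesis by (simp add: algebra_simps)
  qed
  \<comment> \<open>The scaled exponential extended to a complex parameter z, so that complex
    derivatives and the mean value inequality apply.\<close>
  define g where "g r z = exp (\<Sum>l\<in>L. C l * (exp (of_real (A l $ k) * z) * cover_powr r \<theta> (complex_vec (A l))))"
    for r z
  define g' where "g' r z = g r z *
      (\<Sum>l\<in>L. C l * (of_real (A l $ k) * exp (of_real (A l $ k) * z) * cover_powr r \<theta> (complex_vec (A l))))"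
    for r z
  have g_deriv: "(g r has_field_derivative g' r z) (at z within T)" for r z T
    unfolding g_def[abs_def] g'_def
    by (rule derivative_eq_intros refl | simp add: g_def mult_ac)+
  have g_real: "g r (of_real x) = E (S x r)" if "r \<in> pos_orthant" for r x
    unfolding g_def E_def S_def cover_powr_scale[OF that] by simp
  \<comment> \<open>\<open>V r * W r\<close> bounds the derivative for all x in [0,1]: there
    exp(A_lk x) \<le> exp A_lk, and scaling by exp x \<ge> 1 enlarges r, which only improves the
    decay.\<close>
  define W where "W r = (\<Sum>l\<in>L. norm (C l) * A l $ k * exp (A l $ k) * norm (cover_powr r \<theta> (complex_vec (A l))))"
    for r
  define V where "V r = M * exp (- \<epsilon> * (\<Sum>k\<in>UNIV. r $ k))" for r :: "real ^ 'd"
  have g'_bound: "norm (g' r (of_real x)) \<le> V r * W r"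
    if r: "r \<in> pos_orthant" and x: "0 \<le> x" "x \<le> 1" for r x
  proof -
    have "norm (g r (of_real x)) \<le> M * exp (- \<epsilon> * (\<Sum>k\<in>UNIV. S x r $ k))"
      unfolding g_real[OF r] by (rule E_bound[OF S_pos[OF r]])
    also have "\<dots> \<le> V r"
    proof -
      have "r $ i \<le> S x r $ i" for i
        using r x mult_right_mono[of 1 "exp x" "r $ i"] by (auto simp: S_def pos_orthant_def less_imp_le)
      hence "(\<Sum>k\<in>UNIV. r $ k) \<le> (\<Sum>k\<in>UNIV. S x r $ k)" by (intro sum_mono)
      thus ?thesis unfolding V_def using eps M_nonneg by (intro mult_left_mono) auto
    qed
    finally have 1: "norm (g r (of_real x)) \<le> V r" .
    have 2: "norm (\<Sum>l\<in>L. C l * (of_real (A l $ k) * exp (of_real (A l $ k) * of_real x) *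
        cover_powr r \<theta> (complex_vec (A l)))) \<le> W r"
      unfolding W_def
    proof (intro sum_norm_le)
      fix l assume l: "l \<in> L"
      have "A l $ k * x \<le> A l $ k" using nonneg[OF l] x by (simp add: mult_left_le)
      thus "norm (C l * (of_real (A l $ k) * exp (of_real (A l $ k) * of_real x) * cover_powr r \<theta> (complex_vec (A l))))
          \<le> norm (C l) * A l $ k * exp (A l $ k) * norm (cover_powr r \<theta> (complex_vec (A l)))"
        using nonneg[OF l, of k] by (auto simp: norm_mult mult.assoc intro!: mult_left_mono mult_right_mono)
    qed
    show ?thesis unfolding g'_def norm_mult using 1 2 by (intro mult_mono) (auto simp: V_def M_nonneg)
  qed
  have diff_bound: "norm (E (S x r) - E r) \<le> V r * W r * x"
    if r: "r \<in> pos_orthant" and x: "0 \<le> x" "x \<le> 1" for r x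
  proof -
    have "norm (g r (of_real x) - g r (of_real 0)) \<le> V r * W r * norm (of_real x - of_real 0 :: complex)"
    proof (rule field_differentiable_bound[where S = "of_real ` {0..1}", OF _ g_deriv])
      show "convex (complex_of_real ` {0..1})"
        by (intro convex_linear_image) (auto intro!: linearI simp: scaleR_conv_of_real)
    qed (use g'_bound[OF r] x in auto)
    moreover have "S 0 r = r" by (simp add: S_def vec_eq_iff)
    moreover have "norm (of_real x - of_real 0 :: complex) = x" using x by simp
    ultimately show ?thesis by (simp only: g_real[OF r])
  qed
  define s where "s m r = cover_powr r \<theta> (- \<beta> - 1) * ((E (S (X m) r) - E r) / of_real (X m))" for m r
  define s' where "s' r = (\<Sum>l\<in>L. (of_real (A l $ k) * C l) * K (\<beta> - complex_vec (A l)) r)" for r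
  have X: "0 < X m" "X m \<le> 1" for m by (auto simp: X_def field_simps)
  have X_lim: "filterlim (\<lambda>m. complex_of_real (X m)) (at 0) sequentially"
  proof (rule filterlim_atI)
    show "(\<lambda>m. complex_of_real (X m)) \<longlonglongrightarrow> 0"
      using tendsto_of_real[OF LIMSEQ_inverse_real_of_nat, where 'a = complex] by (simp add: X_def)
    show "\<forall>\<^sub>F m in sequentially. complex_of_real (X m) \<noteq> 0"
      using X(1) by (auto simp: less_imp_neq[symmetric])
  qed
  have neg': "Re ((\<beta> - complex_vec (A l)) $ j) < 0" if "l \<in> L" for l j
    using neg[of j] nonneg[OF that, of j] by simp
  have cover_shift: "cover_powr r \<theta> (- \<beta> - 1) * cover_powr r \<theta> (complex_vec (A l))
      = cover_powr r \<theta> (- (\<beta> - complex_vec (A l)) - 1)" for r l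
    unfolding cover_powr_add[symmetric] by (simp add: algebra_simps)
  have dom: "integrable orthant_measure (\<lambda>r. norm (cover_powr r \<theta> (- \<beta> - 1)) * (V r * W r))"
  proof -
    \<comment> \<open>Up to a constant, column l contributes the decaying power at \<beta> - A l,
      still in the domain of convergence. The factor exp(0 * logs r) is the weight for \<eta> =
      0.\<close>
    have "integrable orthant_measure (\<lambda>r. \<Sum>l\<in>L. (M * (norm (C l) * A l $ k * exp (A l $ k))) *
        (exp (0 * logs r) * (norm (cover_powr r \<theta> (- (\<beta> - complex_vec (A l)) - 1)) * exp (- \<epsilon> * (\<Sum>k\<in>UNIV. r $ k)))))"
      using neg' by (intro Bochner_Integration.integrable_sum integrable_mult_right
        integrable_logs_cover) auto
    also have "(\<lambda>r. \<Sum>l\<in>L. (M * (norm (C l) * A l $ k * exp (A l $ k))) *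
        (exp (0 * logs r) * (norm (cover_powr r \<theta> (- (\<beta> - complex_vec (A l)) - 1)) * exp (- \<epsilon> * (\<Sum>k\<in>UNIV. r $ k)))))
      = (\<lambda>r. norm (cover_powr r \<theta> (- \<beta> - 1)) * (V r * W r))"
      unfolding W_def V_def cover_shift[symmetric] norm_mult sum_distrib_left
      by (intro ext sum.cong) (auto simp: mult_ac)
    finally show ?thesis .
  qed
  have s_meas: "s m \<in> borel_measurable borel" for m unfolding s_def by measurable
  have s'_meas: "s' \<in> borel_measurable borel" unfolding s'_def by measurable
  have "(\<lambda>m. \<integral>r. s m r \<partial>orthant_measure) \<longlonglongrightarrow> (\<integral>r. s' r \<partial>orthant_measure)"
  proof (rule integral_dominated_convergence[OF _ _ dom])
    show "AE r in orthant_measure. (\<lambda>m. s m r) \<longlonglongrightarrow> s' r"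
    proof (intro AE_I2)
      fix r :: "real ^ 'd" assume "r \<in> space orthant_measure"
      hence r: "r \<in> pos_orthant" by (simp add: space_orthant_measure)
      have "((\<lambda>z. (g r (0 + z) - g r 0) / z) \<longlongrightarrow> g' r 0) (at 0)"
        using g_deriv[of r 0 UNIV] by (simp add: DERIV_def)
      from filterlim_compose[OF this X_lim]
      have "(\<lambda>m. (g r (of_real (X m)) - g r (of_real 0)) / of_real (X m)) \<longlonglongrightarrow> g' r 0" by simp
      moreover have "S 0 r = r" by (simp add: S_def vec_eq_iff)
      ultimately have "(\<lambda>m. s m r) \<longlonglongrightarrow> cover_powr r \<theta> (- \<beta> - 1) * g' r 0"
        unfolding s_def g_real[OF r] by (intro tendsto_mult tendsto_const) simp
      also have "cover_powr r \<theta> (- \<beta> - 1) * g' r 0 = s' r"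
        unfolding s'_def g'_def K_def cover_shift[symmetric]
        by (simp add: g_def E_def sum_distrib_left sum_distrib_right mult_ac)
      finally show "(\<lambda>m. s m r) \<longlonglongrightarrow> s' r" .
    qed
    show "AE r in orthant_measure. norm (s m r) \<le> norm (cover_powr r \<theta> (- \<beta> - 1)) * (V r * W r)" for m
    proof (intro AE_I2)
      fix r :: "real ^ 'd" assume "r \<in> space orthant_measure"
      hence r: "r \<in> pos_orthant" by (simp add: space_orthant_measure)
      have "norm (E (S (X m) r) - E r) / X m \<le> V r * W r"
        using diff_bound[OF r, of "X m"] X[of m] by (simp add: field_simps)
      thus "norm (s m r) \<le> norm (cover_powr r \<theta> (- \<beta> - 1)) * (V r * W r)"
        unfolding s_def norm_mult norm_divide norm_of_real using X(1)[of m] by (intro mult_left_mono) auto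
    qed
  qed (intro measurable_orthant_measure s_meas s'_meas)+
  also have "(\<integral>r. s' r \<partial>orthant_measure) = (\<Sum>l\<in>L. (of_real (A l $ k) * C l) * mellin (\<beta> - complex_vec (A l)))"
    unfolding s'_def mellin_def using neg'
    by (subst Bochner_Integration.integral_sum) (auto intro!: integrable_mult_right integrable_K)
  finally have lim1: "(\<lambda>m. \<integral>r. s m r \<partial>orthant_measure)
    \<longlonglongrightarrow> (\<Sum>l\<in>L. (of_real (A l $ k) * C l) * mellin (\<beta> - complex_vec (A l)))" .
  have s_int: "(\<integral>r. s m r \<partial>orthant_measure)
      = (exp (\<beta> $ k * of_real (X m)) - 1) / of_real (X m) * mellin \<beta>" for m
  proof -
    have "integrable orthant_measure (\<lambda>r. cover_powr r \<theta> (- \<beta> - 1) * E (S (X m) r))"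
    proof (rule Bochner_Integration.integrable_bound[OF Bochner_Integration.integrable_add[OF
            integrable_norm[OF integrable_K[OF neg]] dom]])
      show "(\<lambda>r. cover_powr r \<theta> (- \<beta> - 1) * E (S (X m) r)) \<in> borel_measurable orthant_measure"
        by (intro measurable_orthant_measure) measurable
      show "AE r in orthant_measure. norm (cover_powr r \<theta> (- \<beta> - 1) * E (S (X m) r))
          \<le> norm (norm (K \<beta> r) + norm (cover_powr r \<theta> (- \<beta> - 1)) * (V r * W r))"
      proof (intro AE_I2)
        fix r :: "real ^ 'd" assume "r \<in> space orthant_measure"
        hence r: "r \<in> pos_orthant" by (simp add: space_orthant_measure)
        have "norm (g' r (of_real 0)) \<le> V r * W r" by (rule g'_bound[OF r]) simp_all
        hence "0 \<le> V r * W r" by (rule order_trans[OF norm_ge_zero])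
        hence "V r * W r * X m \<le> V r * W r" using X[of m] by (simp add: mult_left_le)
        hence "norm (E (S (X m) r)) \<le> norm (E r) + V r * W r"
          using diff_bound[OF r, of "X m"] X[of m] norm_triangle_ineq2[of "E (S (X m) r)" "E r"] by linarith
        from mult_left_mono[OF this norm_ge_zero[of "cover_powr r \<theta> (- \<beta> - 1)"]]
        have "norm (cover_powr r \<theta> (- \<beta> - 1) * E (S (X m) r))
          \<le> norm (K \<beta> r) + norm (cover_powr r \<theta> (- \<beta> - 1)) * (V r * W r)"
          by (simp add: K_def norm_mult algebra_simps)
        thus "norm (cover_powr r \<theta> (- \<beta> - 1) * E (S (X m) r))
          \<le> norm (norm (K \<beta> r) + norm (cover_powr r \<theta> (- \<beta> - 1)) * (V r * W r))" by simp
      qed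
    qed
    hence "J (X m) - mellin \<beta> = (\<integral>r. cover_powr r \<theta> (- \<beta> - 1) * E (S (X m) r) - K \<beta> r \<partial>orthant_measure)"
      unfolding J_def mellin_def using integrable_K[OF neg] by simp
    also have "\<dots> = (\<integral>r. of_real (X m) * s m r \<partial>orthant_measure)"
    proof (intro Bochner_Integration.integral_cong refl)
      fix r
      have "of_real (X m) * s m r = cover_powr r \<theta> (- \<beta> - 1) * (E (S (X m) r) - E r)"
        using X(1)[of m] by (simp add: s_def)
      thus "cover_powr r \<theta> (- \<beta> - 1) * E (S (X m) r) - K \<beta> r = of_real (X m) * s m r"
        by (simp add: K_def right_diff_distrib)
    qed
    finally show ?thesis using X(1)[of m] by (simp add: J field_simps)
  qed
  \<comment> \<open>The same difference quotients, now through the closed form of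
    \<open>J\<close>.\<close>
  have "((\<lambda>z. exp (\<beta> $ k * z)) has_field_derivative \<beta> $ k) (at 0)"
    by (rule derivative_eq_intros refl | simp)+
  hence "((\<lambda>z. (exp (\<beta> $ k * z) - 1) / z) \<longlongrightarrow> \<beta> $ k) (at 0)" by (simp add: DERIV_def)
  from filterlim_compose[OF this X_lim]
  have "(\<lambda>m. \<integral>r. s m r \<partial>orthant_measure) \<longlonglongrightarrow> \<beta> $ k * mellin \<beta>"
    unfolding s_int by (intro tendsto_mult tendsto_const)
  from LIMSEQ_unique[OF this lim1] show ?thesis .
qed

end

section \<open>The exponent on the cycle and the polar set\<close>

text \<open>\<open>R\<close> is where x^(\<alpha> - 1) equals \<eta>: beyond it x^\<alpha> lies
  below \<eta> x, before it x^\<alpha> is at most R^\<alpha>.\<close>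

lemma powr_le_affine:
  fixes \<alpha> \<eta> :: real
  assumes "0 < \<alpha>" "\<alpha> < 1" "0 < \<eta>"
  shows "\<exists>B\<ge>0. \<forall>x\<ge>0. x powr \<alpha> \<le> B + \<eta> * x"
proof -
  define R where "R = \<eta> powr (1 / (\<alpha> - 1))"
  have R: "R > 0" "R powr (\<alpha> - 1) = \<eta>" using assms by (auto simp: R_def powr_powr)
  have "x powr \<alpha> \<le> R powr \<alpha> + \<eta> * x" if x: "x \<ge> 0" for x
  proof (cases "x \<le> R")
    case True
    hence "x powr \<alpha> \<le> R powr \<alpha>" using assms x by (intro powr_mono2) auto
    thus ?thesis using assms x by (simp add: add_increasing2)
  next
    case False
    hence "x powr (\<alpha> - 1) \<le> \<eta>" using assms R powr_mono2'[of "\<alpha> - 1" R x] by simp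
    hence "x * x powr (\<alpha> - 1) \<le> x * \<eta>" using x by (rule mult_left_mono)
    moreover have "x * x powr (\<alpha> - 1) = x powr \<alpha>" using False R by (simp add: powr_diff)
    ultimately show ?thesis by (simp add: add_increasing mult.commute)
  qed
  thus ?thesis by (intro exI[of _ "R powr \<alpha>"]) auto
qed

text \<open>Weights of total mass below 1 make the monomial sublinear, hence negligible against
  the linear exponent.\<close>

lemma monomial_le_affine:
  fixes v :: "real ^ 'd"
  assumes "\<And>k. 0 < v $ k" "(\<Sum>k\<in>UNIV. v $ k) < 1" "0 < \<eta>"
  shows "\<exists>B\<ge>0. \<forall>r\<in>pos_orthant. exp (\<Sum>k\<in>UNIV. v $ k * ln (r $ k)) \<le> B + \<eta> * (\<Sum>k\<in>UNIV. r $ k)"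
proof -
  define \<alpha> where "\<alpha> = (\<Sum>k\<in>UNIV. v $ k)"
  have "0 < \<alpha>" unfolding \<alpha>_def using assms by (intro sum_pos) auto
  then obtain B where B: "B \<ge> 0" "\<And>x. x \<ge> 0 \<Longrightarrow> x powr \<alpha> \<le> B + \<eta> * x"
    using powr_le_affine[of \<alpha> \<eta>] assms by (auto simp: \<alpha>_def)
  have "exp (\<Sum>k\<in>UNIV. v $ k * ln (r $ k)) \<le> B + \<eta> * (\<Sum>k\<in>UNIV. r $ k)"
    if r: "r \<in> pos_orthant" for r :: "real ^ 'd"
  proof -
    \<comment> \<open>Every coordinate is at most this sum and the weights are positive, so the
      monomial is at most x^\<alpha>.\<close>
    define x where "x = (\<Sum>k\<in>UNIV. r $ k)"
    have rk: "0 < r $ k" for k using r by (simp add: pos_orthant_def)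
    have "r $ k \<le> x" for k unfolding x_def using rk by (intro member_le_sum) (auto simp: less_imp_le)
    moreover have x: "0 < x" unfolding x_def using rk by (intro sum_pos) auto
    ultimately have "(\<Sum>k\<in>UNIV. v $ k * ln (r $ k)) \<le> (\<Sum>k\<in>UNIV. v $ k * ln x)"
      using rk assms by (intro sum_mono mult_left_mono) (auto simp: less_imp_le)
    also have "\<dots> = \<alpha> * ln x" by (simp add: \<alpha>_def sum_distrib_right)
    finally have "exp (\<Sum>k\<in>UNIV. v $ k * ln (r $ k)) \<le> x powr \<alpha>" using x by (simp add: powr_def)
    also have "\<dots> \<le> B + \<eta> * x" using B x by simp
    finally show ?thesis by (simp add: x_def)
  qed
  thus ?thesis using B by blast
qed

text \<open>Modulo 2 pi the angle differs from pi by less than pi/2, so t_k lies in the open left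
  half-plane.\<close>

lemma cos_cycle_arg:
  assumes "\<bar>\<delta> $ k\<bar> < 1 / 2"
  shows "cos (cycle_arg p \<delta> $ k) < 0"
proof -
  have "cycle_arg p \<delta> $ k = pi + (\<delta> $ k * pi + 2 * pi * of_int (p $ k))"
    by (simp add: cycle_arg_def algebra_simps)
  hence "cos (cycle_arg p \<delta> $ k) = - cos (\<delta> $ k * pi + 2 * pi * of_int (p $ k))" by simp
  also have "cos (\<delta> $ k * pi + 2 * pi * of_int (p $ k)) = cos (\<delta> $ k * pi)"
    by (simp add: cos_add)
  also have "cos (\<delta> $ k * pi) > 0"
  proof (rule cos_gt_zero_pi)
    have "\<bar>\<delta> $ k * pi\<bar> < pi / 2"
      using assms mult_strict_right_mono[of "\<bar>\<delta> $ k\<bar>" "1 / 2" pi] by (simp add: abs_mult)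
    thus "- (pi / 2) < \<delta> $ k * pi" "\<delta> $ k * pi < pi / 2" by linarith+
  qed
  ultimately show ?thesis by simp
qed

lemma of_real_of_rat: "complex_of_real (of_rat q) = of_rat q"
  by (cases q) (simp add: of_rat_rat)

lemma rat_vec_real: "rat_vec v = complex_vec (rat_vec v)"
  by (simp add: rat_vec_def complex_vec_def of_real_of_rat)

text \<open>For a real exponent the modulus depends only on r and the argument only on \<theta>, so
  the argument is constant along the cycle.\<close>

lemma cover_powr_real:
  "cover_powr r \<theta> (complex_vec v) =
     rcis (exp (\<Sum>k\<in>UNIV. v $ k * ln (r $ k))) (\<Sum>k\<in>UNIV. v $ k * \<theta> $ k)"
proof -
  have "(\<Sum>k\<in>UNIV. complex_of_real (v $ k) * (complex_of_real (ln (r $ k)) + \<i> * complex_of_real (\<theta> $ k)))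
    = complex_of_real (\<Sum>k\<in>UNIV. v $ k * ln (r $ k)) + \<i> * complex_of_real (\<Sum>k\<in>UNIV. v $ k * \<theta> $ k)"
    by (simp add: sum.distrib algebra_simps sum_distrib_left)
  thus ?thesis by (simp only: cover_powr_def complex_vec_nth rcis_def cis_conv_exp exp_add exp_of_real)
qed

text \<open>The sector prescribes the argument of y_n t^(a(n)), which does not vary along the cycle,
  to lie in the left half-plane. A sign is obtained whatever the size of the term.\<close>

lemma sector_term_nonpos:
  assumes "z \<in> sector n a p \<delta>"
  shows "Re (z * cover_powr r (cycle_arg p \<delta>) (rat_vec (a n))) \<le> 0"
proof -
  define \<phi> where "\<phi> = (\<Sum>k\<in>UNIV. (1 + \<delta> $ k + 2 * of_int (p $ k)) * of_rat (a n $ k)) * pi"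
  obtain m :: int where z: "z \<noteq> 0"
    and m: "Arg z + \<phi> \<in> {pi / 2 + 2 * pi * of_int m <..< 3 * pi / 2 + 2 * pi * of_int m}"
    using assms unfolding sector_def \<phi>_def by blast
  have "(\<Sum>k\<in>UNIV. rat_vec (a n) $ k * cycle_arg p \<delta> $ k) = \<phi>"
    unfolding \<phi>_def sum_distrib_right
    by (intro sum.cong) (auto simp: rat_vec_def cycle_arg_def mult_ac)
  hence eq: "z * cover_powr r (cycle_arg p \<delta>) (rat_vec (a n)) =
      rcis (norm z * exp (\<Sum>k\<in>UNIV. rat_vec (a n) $ k * ln (r $ k))) (Arg z + \<phi>)"
    by (subst rat_vec_real, subst cover_powr_real, subst rcis_cmod_Arg[of z, symmetric])
       (simp only: rcis_mult)
  have "cos (Arg z + \<phi>) \<le> 0"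
  proof -
    \<comment> \<open>The sector condition places \<open>t\<close> in ]-pi/2, pi/2[.\<close>
    define t where "t = Arg z + \<phi> - pi - 2 * pi * of_int m"
    have "cos (Arg z + \<phi>) = cos (pi + (t + 2 * pi * of_int m))" by (simp add: t_def)
    also have "\<dots> = - cos t" by (simp add: cos_add)
    finally have "cos (Arg z + \<phi>) = - cos t" .
    moreover have "cos t \<ge> 0" using m by (intro cos_ge_zero) (auto simp: t_def)
    ultimately show ?thesis by simp
  qed
  thus ?thesis unfolding eq Re_rcis by (intro mult_nonneg_nonpos) auto
qed

section \<open>The column monoid and its hyperplanes\<close>

lemma zero_in_column_monoid: "0 \<in> column_monoid n a"
  unfolding column_monoid_def by (rule CollectI, rule exI[of _ "\<lambda>_. 0"]) simp

lemma column_monoid_add_column: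
  assumes "v \<in> column_monoid n a" "l \<in> {1..n}"
  shows "v + a l \<in> column_monoid n a"
proof -
  obtain c where v: "v = (\<Sum>l = 1..n. of_nat (c l) *s a l)"
    using assms by (auto simp: column_monoid_def)
  have "(\<Sum>j = 1..n. of_nat ((c(l := Suc (c l))) j) *s a j)
      = (\<Sum>j = 1..n. of_nat (c j) *s a j + (if j = l then a l else 0))"
    by (intro sum.cong) (auto simp: vec_eq_iff algebra_simps)
  also have "\<dots> = v + a l" using assms(2) by (simp add: v sum.distrib)
  finally have "v + a l = (\<Sum>j = 1..n. of_nat ((c(l := Suc (c l))) j) *s a j)" by (rule sym)
  thus ?thesis unfolding column_monoid_def by blast
qed

text \<open>All summands are nonnegative, so a positive entry limits its multiplicity to less than B
  / a l $ k, and only finitely many sums remain.\<close>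

lemma finite_coordinates_below:
  assumes "\<And>l. l \<in> {1..n} \<Longrightarrow> 0 \<le> a l $ k"
  shows "finite {q \<in> (\<lambda>v. v $ k) ` column_monoid n a. q < B}"
proof -
  obtain N where N: "\<And>l. l \<in> {1..n} \<Longrightarrow> a l $ k \<noteq> 0 \<Longrightarrow> B / a l $ k < of_nat N"
  proof -
    obtain f :: "nat \<Rightarrow> nat" where f: "\<And>l. B / a l $ k < of_nat (f l)"
    proof -
      have "\<forall>l. \<exists>N::nat. B / a l $ k < of_nat N" using reals_Archimedean2 by blast
      then obtain f :: "nat \<Rightarrow> nat" where "\<forall>l. B / a l $ k < of_nat (f l)" by (rule choice[THEN exE])
      thus ?thesis using that by blast
    qed
    have "B / a l $ k < of_nat (\<Sum>l = 1..n. f l)" if "l \<in> {1..n}" for l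
    proof -
      have "f l \<le> (\<Sum>l = 1..n. f l)" using that by (intro member_le_sum) auto
      thus ?thesis using f[of l] by (metis less_le_trans of_nat_le_iff)
    qed
    thus ?thesis using that by blast
  qed
  have "{q \<in> (\<lambda>v. v $ k) ` column_monoid n a. q < B}
     \<subseteq> (\<lambda>c. \<Sum>l = 1..n. of_nat (c l) * a l $ k) ` ({1..n} \<rightarrow>\<^sub>E {..N})"
  proof
    fix q assume "q \<in> {q \<in> (\<lambda>v. v $ k) ` column_monoid n a. q < B}"
    then obtain c where q: "q = (\<Sum>l = 1..n. of_nat (c l) * a l $ k)" and qB: "q < B"
      by (auto simp: column_monoid_def)
    \<comment> \<open>A zero entry leaves its multiplicity unbounded without affecting
      \<open>q\<close>, so that multiplicity is reset to 0. Restricting to the index range puts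
      \<open>c'\<close> into a finite function space.\<close>
    define c' where "c' = (\<lambda>l\<in>{1..n}. if a l $ k = 0 then 0 else c l)"
    have "q = (\<Sum>l = 1..n. of_nat (c' l) * a l $ k)"
      unfolding q by (intro sum.cong) (auto simp: c'_def)
    moreover have "c' \<in> {1..n} \<rightarrow>\<^sub>E {..N}"
    proof -
      have "c l \<le> N" if l: "l \<in> {1..n}" "a l $ k \<noteq> 0" for l
      proof -
        have "of_nat (c l) * a l $ k \<le> q"
          unfolding q using assms l by (intro member_le_sum) auto
        hence "of_nat (c l) * a l $ k < B" using qB by simp
        moreover have "0 < a l $ k" using assms[OF l(1)] l(2) by simp
        ultimately have "of_nat (c l) < B / a l $ k" by (simp add: field_simps)
        also have "\<dots> < of_nat N" using N[OF l] .
        finally show ?thesis by simp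
      qed
      thus ?thesis by (auto simp: c'_def)
    qed
    ultimately show "q \<in> (\<lambda>c. \<Sum>l = 1..n. of_nat (c l) * a l $ k) ` ({1..n} \<rightarrow>\<^sub>E {..N})" by blast
  qed
  moreover have "finite ((\<lambda>c. \<Sum>l = 1..n. of_nat (c l) * a l $ k) ` ({1..n} \<rightarrow>\<^sub>E {..N}))"
    by (rule finite_imageI, rule finite_PiE) simp_all
  ultimately show ?thesis by (rule finite_subset)
qed

lemma countable_polar_hyperplanes: "countable (polar_hyperplanes n (a :: nat \<Rightarrow> rat ^ 'd))"
proof (rule countable_subset)
  show "polar_hyperplanes n a \<subseteq> (\<Union>k. range (\<lambda>q. {\<beta>. \<beta> $ k = of_rat q}))"
    unfolding polar_hyperplanes_def by blast
  show "countable (\<Union>k::'d. range (\<lambda>q. {\<beta> :: complex ^ 'd. \<beta> $ k = of_rat q}))"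
    by (rule countable_UN[OF countable_finite[OF finite]], rule countable_image, rule countableI_type)
qed

lemma Union_polar_hyperplanes: "\<Union> (polar_hyperplanes n a) = polar_set n a"
  unfolding polar_hyperplanes_def polar_set_def by blast

text \<open>Coordinates of the monoid are finite in number below any bound, so a neighbourhood
  bounding only the real parts from above meets finitely many hyperplanes.\<close>

lemma locally_finite_polar_hyperplanes:
  fixes a :: "nat \<Rightarrow> rat ^ 'd"
  assumes "\<And>l k. l \<in> {1..n} \<Longrightarrow> 0 \<le> a l $ k"
  shows "locally_finite_in euclidean (polar_hyperplanes n a)"
  unfolding locally_finite_in_def
proof (intro conjI ballI)
  fix x :: "complex ^ 'd"
  obtain B :: nat where B: "\<And>k. Re (x $ k) < of_nat B"
  proof -
    obtain B :: nat where "norm x < of_nat B" using reals_Archimedean2 by blast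
    hence "Re (x $ k) < of_nat B" for k
      using complex_Re_le_cmod[of "x $ k"] Finite_Cartesian_Product.norm_nth_le[of x k] by linarith
    thus ?thesis using that by blast
  qed
  define V where "V = (\<Inter>k. {w :: complex ^ 'd. Re (w $ k) < of_nat B})"
  have "open V" unfolding V_def by (intro open_INT ballI open_Collect_less continuous_intros) simp
  moreover have "x \<in> V" using B by (simp add: V_def)
  moreover have "finite {U \<in> polar_hyperplanes n a. U \<inter> V \<noteq> {}}"
  proof (rule finite_subset)
    show "{U \<in> polar_hyperplanes n a. U \<inter> V \<noteq> {}} \<subseteq> (\<Union>k. (\<lambda>q. {\<beta>. \<beta> $ k = of_rat q}) `
        {q \<in> (\<lambda>v. v $ k) ` column_monoid n a. q < of_nat B})"
    proof
      fix U assume U: "U \<in> {U \<in> polar_hyperplanes n a. U \<inter> V \<noteq> {}}"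
      then obtain k q where kq: "U = {\<beta>. \<beta> $ k = of_rat q}" "q \<in> (\<lambda>v. v $ k) ` column_monoid n a"
        unfolding polar_hyperplanes_def by blast
      from U obtain w where "w \<in> U" "w \<in> V" by blast
      hence "w $ k = of_rat q" "Re (w $ k) < of_nat B" unfolding kq(1) V_def by blast+
      hence "Re (of_rat q) < of_nat B" by simp
      moreover have "Re (of_rat q) = of_rat q"
        by (metis Re_complex_of_real of_real_of_rat)
      ultimately have "of_rat q < (of_rat (of_nat B) :: real)" by simp
      hence "q < of_nat B" by (simp only: of_rat_less)
      thus "U \<in> (\<Union>k. (\<lambda>q. {\<beta>. \<beta> $ k = of_rat q}) `
        {q \<in> (\<lambda>v. v $ k) ` column_monoid n a. q < of_nat B})" using kq by blast
    qed
    show "finite (\<Union>k. (\<lambda>q. {\<beta> :: complex ^ 'd. \<beta> $ k = of_rat q}) `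
        {q \<in> (\<lambda>v. v $ k) ` column_monoid n a. q < of_nat B})"
      using assms by (intro finite_UN_I finite_imageI finite_coordinates_below) auto
  qed
  ultimately show "\<exists>V. openin euclidean V \<and> x \<in> V \<and> finite {U \<in> polar_hyperplanes n a. U \<inter> V \<noteq> {}}"
    unfolding open_openin[symmetric] by blast
qed simp

text \<open>Shows that t_1, ..., t_d are the monomials of the unit columns. Positivity is needed to
  recover r_k from its logarithm.\<close>

lemma cover_powr_axis:
  assumes "r \<in> pos_orthant"
  shows "cover_powr r \<theta> (rat_vec (axis k 1)) = rcis (r $ k) (\<theta> $ k)"
proof -
  have "rat_vec (axis k 1) $ i = (if i = k then 1 else 0 :: real)" for i
    by (simp add: rat_vec_def axis_def)
  hence "(\<Sum>i\<in>UNIV. rat_vec (axis k 1) $ i * x i) = (\<Sum>i\<in>UNIV. if i = k then x i else 0)" for x :: "'a \<Rightarrow> real"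
    by (intro sum.cong) auto
  hence *: "(\<Sum>i\<in>UNIV. rat_vec (axis k 1) $ i * x i) = x k" for x :: "'a \<Rightarrow> real" by simp
  show ?thesis using assms by (subst rat_vec_real) (simp add: cover_powr_real * pos_orthant_def)
qed

lemma polar_set_shift:
  assumes "l \<in> {1..n}" "\<beta> - rat_vec (a l) \<in> polar_set n a"
  shows "\<beta> \<in> polar_set n a"
proof -
  obtain k v where v: "v \<in> column_monoid n a" "(\<beta> - rat_vec (a l)) $ k = of_rat (v $ k)"
    using assms(2) unfolding polar_set_def by blast
  have "\<beta> $ k = of_rat ((v + a l) $ k)" using v(2) by (simp add: rat_vec_def of_rat_add algebra_simps)
  thus ?thesis using column_monoid_add_column[OF v(1) assms(1)] unfolding polar_set_def by blast
qed

lemma polar_set_zero: "\<beta> $ k = 0 \<Longrightarrow> \<beta> \<in> polar_set n a"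
proof -
  assume "\<beta> $ k = 0"
  hence "\<beta> $ k = of_rat ((0 :: rat ^ 'a) $ k)" by simp
  thus ?thesis using zero_in_column_monoid[of n a] unfolding polar_set_def by blast
qed

text \<open>With s the sum of the r_k, the linear terms give at most -c s, the sublinear columns
  cost at most c s / 2 plus a constant, and the last column adds nothing positive. Hence \<epsilon>
  = c / 2.\<close>

lemma exponent_bound:
  fixes a :: "nat \<Rightarrow> rat ^ 'd"
  assumes n: "CARD('d) < n"
    and cond1: "\<And>j. j \<in> {CARD('d) + 1..n - 1} \<Longrightarrow> (\<forall>k. 0 < a j $ k) \<and> (\<Sum>k\<in>UNIV. a j $ k) < 1"
    and \<delta>: "\<And>k. \<bar>\<delta> $ k\<bar> < 1 / 2"
    and y: "y n \<in> sector n a p \<delta>"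
  shows "\<exists>\<epsilon> B. 0 < \<epsilon> \<and> (\<forall>r\<in>pos_orthant.
     Re ((\<Sum>k\<in>UNIV. rcis (r $ k) (cycle_arg p \<delta> $ k)) +
         (\<Sum>j = CARD('d) + 1..n. y j * cover_powr r (cycle_arg p \<delta>) (rat_vec (a j))))
       \<le> B - \<epsilon> * (\<Sum>k\<in>UNIV. r $ k))"
proof -
  define \<theta> where "\<theta> = cycle_arg p \<delta>"
  define J where "J = {CARD('d) + 1..n - 1}"
  define c where "c = Min (range (\<lambda>k. - cos (\<theta> $ k)))"
  have c: "0 < c" unfolding c_def using cos_cycle_arg[OF \<delta>] by (subst Min_gr_iff) (auto simp: \<theta>_def)
  have c_le: "cos (\<theta> $ k) \<le> - c" for k
  proof -
    have "c \<le> - cos (\<theta> $ k)" unfolding c_def by (rule Min_le) auto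
    thus ?thesis by simp
  qed
  define Y where "Y = (\<Sum>j\<in>J. norm (y j))"
  have Y: "0 \<le> Y" by (simp add: Y_def sum_nonneg)
  \<comment> \<open>Chosen so that the total slope \<open>Y * \<eta>\<close> is at most c / 2; the
    summand 1 avoids division by 0 when \<open>Y = 0\<close>.\<close>
  define \<eta> where "\<eta> = c / (2 * (1 + Y))"
  have \<eta>: "0 < \<eta>" using c Y by (simp add: \<eta>_def)
  have Y\<eta>: "Y * \<eta> \<le> c / 2" using c Y by (simp add: \<eta>_def field_simps)
  have "\<forall>j\<in>J. \<exists>B. \<forall>r\<in>pos_orthant. exp (\<Sum>k\<in>UNIV. rat_vec (a j) $ k * ln (r $ k)) \<le> B + \<eta> * (\<Sum>k\<in>UNIV. r $ k)"
  proof
    fix j assume "j \<in> J"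
    hence j: "\<And>k. 0 < a j $ k" "(\<Sum>k\<in>UNIV. a j $ k) < 1" using cond1 by (auto simp: J_def)
    have "(\<Sum>k\<in>UNIV. rat_vec (a j) $ k) = (of_rat (\<Sum>k\<in>UNIV. a j $ k) :: real)"
      by (simp add: rat_vec_def of_rat_sum)
    also have "\<dots> < 1" using j(2) by simp
    finally show "\<exists>B. \<forall>r\<in>pos_orthant. exp (\<Sum>k\<in>UNIV. rat_vec (a j) $ k * ln (r $ k)) \<le> B + \<eta> * (\<Sum>k\<in>UNIV. r $ k)"
      using monomial_le_affine[of "rat_vec (a j)" \<eta>] j(1) \<eta> by (auto simp: rat_vec_def)
  qed
  from bchoice[OF this] obtain B where "\<forall>j\<in>J. \<forall>r\<in>pos_orthant.
      exp (\<Sum>k\<in>UNIV. rat_vec (a j) $ k * ln (r $ k)) \<le> B j + \<eta> * (\<Sum>k\<in>UNIV. r $ k)" ..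
  hence B: "exp (\<Sum>k\<in>UNIV. rat_vec (a j) $ k * ln (r $ k)) \<le> B j + \<eta> * (\<Sum>k\<in>UNIV. r $ k)"
    if "j \<in> J" "r \<in> pos_orthant" for j r
    using that by blast
  have "Re ((\<Sum>k\<in>UNIV. rcis (r $ k) (\<theta> $ k)) + (\<Sum>j = CARD('d) + 1..n. y j * cover_powr r \<theta> (rat_vec (a j))))
      \<le> (\<Sum>j\<in>J. norm (y j) * B j) - c / 2 * (\<Sum>k\<in>UNIV. r $ k)" if r: "r \<in> pos_orthant" for r
  proof -
    define s where "s = (\<Sum>k\<in>UNIV. r $ k)"
    have rk: "0 < r $ k" for k using r by (simp add: pos_orthant_def)
    have s: "0 \<le> s" unfolding s_def using rk by (intro sum_nonneg) (simp add: less_imp_le)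
    have lin: "Re (\<Sum>k\<in>UNIV. rcis (r $ k) (\<theta> $ k)) \<le> - c * s"
      unfolding s_def Re_sum Re_rcis sum_distrib_left using mult_left_mono[OF c_le less_imp_le[OF rk]]
      by (intro sum_mono) (simp add: mult.commute)
    have "Re (\<Sum>j\<in>J. y j * cover_powr r \<theta> (rat_vec (a j))) \<le> (\<Sum>j\<in>J. norm (y j) * (B j + \<eta> * s))"
      unfolding Re_sum
    proof (intro sum_mono)
      fix j assume j: "j \<in> J"
      have "Re (y j * cover_powr r \<theta> (rat_vec (a j))) \<le> norm (y j) * norm (cover_powr r \<theta> (rat_vec (a j)))"
        by (metis complex_Re_le_cmod norm_mult)
      also have "norm (cover_powr r \<theta> (rat_vec (a j))) = exp (\<Sum>k\<in>UNIV. rat_vec (a j) $ k * ln (r $ k))"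
        by (subst rat_vec_real) (simp add: cover_powr_real)
      also have "norm (y j) * \<dots> \<le> norm (y j) * (B j + \<eta> * s)"
        unfolding s_def using B[OF j r] by (intro mult_left_mono) auto
      finally show "Re (y j * cover_powr r \<theta> (rat_vec (a j))) \<le> norm (y j) * (B j + \<eta> * s)" .
    qed
    also have "\<dots> = (\<Sum>j\<in>J. norm (y j) * B j) + Y * \<eta> * s"
      unfolding Y_def sum_distrib_right sum.distrib[symmetric]
      by (intro sum.cong) (auto simp: algebra_simps)
    also have "\<dots> \<le> (\<Sum>j\<in>J. norm (y j) * B j) + c / 2 * s"
      using Y\<eta> s by (intro add_left_mono mult_right_mono)
    finally have sub: "Re (\<Sum>j\<in>J. y j * cover_powr r \<theta> (rat_vec (a j))) \<le> (\<Sum>j\<in>J. norm (y j) * B j) + c / 2 * s" .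
    have "{CARD('d) + 1..n} = insert n J" "n \<notin> J" "finite J" using n by (auto simp: J_def)
    hence "(\<Sum>j = CARD('d) + 1..n. y j * cover_powr r \<theta> (rat_vec (a j)))
        = y n * cover_powr r \<theta> (rat_vec (a n)) + (\<Sum>j\<in>J. y j * cover_powr r \<theta> (rat_vec (a j)))"
      by simp
    thus ?thesis
      using lin sub sector_term_nonpos[OF y, of r] by (simp add: \<theta>_def[symmetric] s_def[symmetric])
  qed
  thus ?thesis using c
    by (intro exI[of _ "c / 2"] exI[of _ "\<Sum>j\<in>J. norm (y j) * B j"]) (auto simp: \<theta>_def)
qed

text \<open>The index type carries no order, so \<open>\<kappa>\<close> records which coordinate is
  the l-th one. Integrability is asserted separately because the integral of a non-integrable
  function is 0 by default, and the formula for \<open>F'\<close> alone would not express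
  convergence.\<close>

theorem lemma4p11:
  fixes n :: nat
    and \<kappa> :: "nat \<Rightarrow> 'd::finite"
    and a :: "nat \<Rightarrow> rat ^ 'd"
    and p :: "int ^ 'd"
    and \<delta> :: "real ^ 'd"
    and y :: "nat \<Rightarrow> complex"
  assumes "CARD('d) < n"
    and numbering: "bij_betw \<kappa> {1..CARD('d)} UNIV"
    and identity: "\<And>l. l \<in> {1..CARD('d)} \<Longrightarrow> a l = axis (\<kappa> l) 1"
    and cond1: "\<And>j. j \<in> {CARD('d) + 1..n - 1} \<Longrightarrow>
                  (\<forall>k. 0 < a j $ k) \<and> (\<Sum>k\<in>UNIV. a j $ k) < 1"
    and cond2: "(\<forall>k. 0 < a n $ k) \<and> (\<Sum>k\<in>UNIV. a n $ k) > 1"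
    and "\<And>k. \<bar>\<delta> $ k\<bar> < 1 / 2"
    and "y n \<in> sector n a p \<delta>"
  shows "(\<forall>\<beta>. (\<forall>k. Re (\<beta> $ k) < 0) \<longrightarrow>
            set_integrable lborel pos_orthant (F_integrand n a p \<delta> \<beta> y)) \<and>
         countable (polar_hyperplanes n a) \<and>
         locally_finite_in euclidean (polar_hyperplanes n a) \<and>
         \<Union> (polar_hyperplanes n a) = polar_set n a \<and>
         (\<exists>F'. F' meromorphic_on_vec UNIV \<and>
               F' holomorphic_on_vec (- polar_set n a) \<and>
               (\<forall>\<beta>. (\<forall>k. Re (\<beta> $ k) < 0) \<longrightarrow> F' \<beta> = F_integral n a p \<delta> \<beta> y))"
proof -
  define \<theta> where "\<theta> = cycle_arg p \<delta>"
  define A :: "nat \<Rightarrow> real ^ 'd" where "A l = rat_vec (a l)" for l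
  \<comment> \<open>The unit columns receive coefficient 1, which turns the linear part of the
    exponent into ordinary summands.\<close>
  define C where "C l = (if l \<le> CARD('d) then 1 else y l)" for l
  have vec_A: "complex_vec (A l) = rat_vec (a l)" for l
    by (simp add: A_def rat_vec_real[of "a l"])
  have a_nonneg: "0 \<le> a l $ k" if "l \<in> {1..n}" for l k
  proof -
    have "l \<in> {1..CARD('d)} \<or> l \<in> {CARD('d) + 1..n - 1} \<or> l = n"
      using that unfolding atLeastAtMost_iff by linarith
    then consider "l \<in> {1..CARD('d)}" | "l \<in> {CARD('d) + 1..n - 1}" | "l = n" by blast
    thus ?thesis
    proof cases
      case 1 thus ?thesis using identity by (simp add: axis_def)
    next
      case 2 thus ?thesis using cond1 by (simp add: less_imp_le)
    next
      case 3 thus ?thesis using cond2 by (simp add: less_imp_le)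
    qed
  qed
  have exponent: "(\<Sum>l\<in>{1..n}. C l * cover_powr r \<theta> (rat_vec (a l))) =
      (\<Sum>k\<in>UNIV. rcis (r $ k) (\<theta> $ k)) + (\<Sum>j = CARD('d) + 1..n. y j * cover_powr r \<theta> (rat_vec (a j)))"
    if r: "r \<in> pos_orthant" for r
  proof -
    have "{1..n} = {1..CARD('d)} \<union> {CARD('d) + 1..n}" using assms(1) by auto
    hence "(\<Sum>l\<in>{1..n}. C l * cover_powr r \<theta> (rat_vec (a l))) =
        (\<Sum>l\<in>{1..CARD('d)}. C l * cover_powr r \<theta> (rat_vec (a l))) +
        (\<Sum>l\<in>{CARD('d) + 1..n}. C l * cover_powr r \<theta> (rat_vec (a l)))"
      by (simp only:) (rule sum.union_disjoint; auto)
    also have "(\<Sum>l\<in>{1..CARD('d)}. C l * cover_powr r \<theta> (rat_vec (a l)))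
        = (\<Sum>l\<in>{1..CARD('d)}. rcis (r $ \<kappa> l) (\<theta> $ \<kappa> l))"
      by (intro sum.cong) (auto simp: C_def identity cover_powr_axis[OF r])
    also have "\<dots> = (\<Sum>k\<in>UNIV. rcis (r $ k) (\<theta> $ k))"
      by (rule sum.reindex_bij_betw[OF numbering])
    also have "(\<Sum>l\<in>{CARD('d) + 1..n}. C l * cover_powr r \<theta> (rat_vec (a l)))
        = (\<Sum>j = CARD('d) + 1..n. y j * cover_powr r \<theta> (rat_vec (a j)))"
      by (intro sum.cong) (auto simp: C_def)
    finally show ?thesis .
  qed
  obtain \<epsilon> B where \<epsilon>: "0 < \<epsilon>" and "\<forall>r\<in>pos_orthant.
      Re ((\<Sum>k\<in>UNIV. rcis (r $ k) (\<theta> $ k)) + (\<Sum>j = CARD('d) + 1..n. y j * cover_powr r \<theta> (rat_vec (a j))))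
        \<le> B - \<epsilon> * (\<Sum>k\<in>UNIV. r $ k)"
    using exponent_bound[of n a \<delta> y p, OF assms(1) cond1 assms(6,7)] unfolding \<theta>_def by blast
  hence B: "Re (\<Sum>l\<in>{1..n}. C l * cover_powr r \<theta> (rat_vec (a l))) \<le> B - \<epsilon> * (\<Sum>k\<in>UNIV. r $ k)"
    if "r \<in> pos_orthant" for r
    unfolding exponent[OF that] using that by blast
  interpret E: exponential_sum "{1..n}" A C \<theta> \<epsilon> "exp B"
  proof
    show "norm (exp (\<Sum>l\<in>{1..n}. C l * cover_powr r \<theta> (complex_vec (A l))))
        \<le> exp B * exp (- \<epsilon> * (\<Sum>k\<in>UNIV. r $ k))" if "r \<in> pos_orthant" for r
      using B[OF that] by (simp add: vec_A flip: exp_add)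
  qed (use \<epsilon> a_nonneg in \<open>auto simp: A_def rat_vec_def\<close>)
  \<comment> \<open>The factor of dt coming from the constant angles.\<close>
  define c where "c = (\<Prod>k\<in>UNIV. cis (\<theta> $ k))"
  have integrand: "F_integrand n a p \<delta> \<beta> y r = c * E.K \<beta> r" if r: "r \<in> pos_orthant" for \<beta> r
    unfolding F_integrand_def Let_def \<theta>_def[symmetric] E.K_def E.E_def vec_A exponent[OF r] c_def
    by (simp only: mult_ac)
  have integrable: "set_integrable lborel pos_orthant (F_integrand n a p \<delta> \<beta> y)"
    if "\<forall>k. Re (\<beta> $ k) < 0" for \<beta>
  proof -
    have "integrable orthant_measure (\<lambda>r. c * E.K \<beta> r)"
      using that by (intro integrable_mult_right E.integrable_K) auto
    also have "?this \<longleftrightarrow> integrable orthant_measure (F_integrand n a p \<delta> \<beta> y)"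
      by (intro Bochner_Integration.integrable_cong) (auto simp: space_orthant_measure integrand)
    finally show ?thesis by (simp only: integrable_orthant_measure)
  qed
  have integral: "F_integral n a p \<delta> \<beta> y = c * E.mellin \<beta>" for \<beta>
  proof -
    have "F_integral n a p \<delta> \<beta> y = (\<integral>r. F_integrand n a p \<delta> \<beta> y r \<partial>orthant_measure)"
      by (simp only: F_integral_def integral_orthant_measure)
    also have "\<dots> = (\<integral>r. c * E.K \<beta> r \<partial>orthant_measure)"
      by (intro Bochner_Integration.integral_cong) (auto simp: space_orthant_measure integrand)
    finally show ?thesis by (simp only: E.mellin_def integral_mult_right_zero)
  qed
  \<comment> \<open>The coefficient contains the entry \<open>A l $ k\<close> as a factor, so it
    vanishes with it, as \<open>coeff0\<close> requires.\<close>
  interpret S: shift_equation "{1..n}" A "\<lambda>l k. of_real (A l $ k) * C l" "\<lambda>\<beta>. c * E.mellin \<beta>" "polar_set n a"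
  proof
    show "(\<lambda>\<beta>. c * E.mellin \<beta>) holomorphic_on_vec {\<beta>. \<forall>k. Re (\<beta> $ k) < 0}"
      by (intro holomorphic_on_vec_mult holomorphic_on_vec_const E.mellin_holomorphic)
    show "\<beta> $ k * (c * E.mellin \<beta>) = (\<Sum>l\<in>{1..n}. of_real (A l $ k) * C l *
        (c * E.mellin (\<beta> - complex_vec (A l))))" if "\<And>j. Re (\<beta> $ j) < 0" for \<beta> k
    proof -
      have "c * (\<beta> $ k * E.mellin \<beta>) =
          c * (\<Sum>l\<in>{1..n}. of_real (A l $ k) * C l * E.mellin (\<beta> - complex_vec (A l)))"
        by (simp only: E.mellin_equation[OF that])
      thus ?thesis by (simp only: sum_distrib_left mult_ac)
    qed
  qed (use E.nonneg polar_set_zero polar_set_shift[of _ n _ a] in \<open>auto simp: vec_A\<close>)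
  show ?thesis
    using integrable countable_polar_hyperplanes[of n a] locally_finite_polar_hyperplanes[of n a, OF a_nonneg]
      Union_polar_hyperplanes[of n a] S.continuation unfolding integral by blast
qed

end
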